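(* Let $M$ be a connected 2-dimensional manifold. Let $X:M\to H^3$ be an immersed surface without umbilics and with Gauss curvature $K\neq -1$ everywhere, and let $N:M\to S_1^3$ be a space-like immersed surface without umbilics and with Gauss curvature $\neq 1$ everywhere. Suppose that $N:M\to S_1^3$ is the generalized Gauss map of $X:M\to H^3$, and vice versa ($X:M\to H^3$ is the generalized Gauss map of $N:M\to S_1^3$). Then the normal Gauss map of $X:M\to H^3$ is conformal if and only if the normal Gauss map of $N:M\to S_1^3$ is conformal. Moreover, in this case, $$dV_N=\left(\frac{N_0-N_3}{X_3-X_0}\right)^2dV_X,$$ where $dV_X$ and $dV_N$ are the volume elements of the metrics on $M$ induced by $X$ and $N$ respectively.
   Context: Minkowski models. $L^4$ is $\mathbb R^4$ with coordinates $X_0,X_1,X_2,X_3$ and scalar product $-X_0^2+X_1^2+X_2^2+X_3^2$. $H^3=\{-X_0^2+X_1^2+X_2^2+X_3^2=-1,\ X_0>0\}$ and $S_1^3=\{-X_0^2+X_1^2+X_2^2+X_3^2=1\}$, with the induced metrics. Components of the maps are $X=(X_0,X_1,X_2,X_3)$ and $N=(N_0,N_1,N_2,N_3)$. Generalized Gauss map. For an immersed surface $X:M\to H^3$ with (space-like) unit normal $N$ tangent to $H^3$, parallel translation of $N$ to the origin of $L^4$ gives a map $N:M\to S_1^3$; for a space-like immersed surface $X:M\to S_1^3$ with time-like unit normal $N$ tangent to $S_1^3$, the same gives a map $N:M\to H^3$. These maps are called the generalized Gauss maps. Upper half-space models. Let $R_+^3=\{(x_1,x_2,x_3): x_3>0\}$.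 $H^3$ is identified isometrically with $R_+^3$ with metric $\frac1{x_3^2}(dx_1^2+dx_2^2+dx_3^2)$ by $(x_1,x_2,x_3)=\left(\frac{X_1}{X_0-X_3},\frac{X_2}{X_0-X_3},\frac1{X_0-X_3}\right)$. Each of $S_-=\{X\in S_1^3:X_0-X_3<0\}$ and $S_+=\{X\in S_1^3:X_0-X_3>0\}$ is identified isometrically with $R_+^3$ with the Lorentz metric $\frac1{x_3^2}(dx_1^2+dx_2^2-dx_3^2)$ by $(x_1,x_2,x_3)=\left(\frac{X_1}{|X_0-X_3|},\frac{X_2}{|X_0-X_3|},\frac1{|X_0-X_3|}\right)$. Normal Gauss map. In the upper half-space model write the unit normal of a surface in $H^3$ (resp. the time-like unit normal of a space-like surface in $S_1^3$) as $\sum_{A=1}^3x_3\eta_A\frac{\partial}{\partial x_A}$, with $\eta_1^2+\eta_2^2+\eta_3^2=1$ (resp. $\eta_1^2+\eta_2^2-\eta_3^2=-1$). The normal Gauss map is $\widetilde N=(\eta_1,\eta_2,\eta_3)$, with values in $S^2(1)\subset\mathbb R^3$ (resp. $H^2(-1)\subset L^3$, where $L^3$ is $\mathbb R^3$ with the product $dx_1^2+dx_2^2-dx_3^2$). For a space-like surface in $S_1^3$ it is considered on the open dense subset of $M$ mapped into $S_-\cup S_+$. Conformality. With ambient connection $D$ and induced connection $\nabla$, and $\nu$ the chosen unit normal, the second fundamental form $\mathrm{II}$ is given by $D_YZ=\nabla_YZ+\mathrm{II}(Y,Z)\nu$; the fourth fundamental form is $\mathrm{IV}=\langle d\widetilde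 N,d\widetilde N\rangle$ (Euclidean metric of $\mathbb R^3$ for $H^3$, metric of $L^3$ for $S_1^3$). The normal Gauss map is conformal if $\mathrm{IV}=\rho\,\mathrm{II}$ for some smooth function $\rho$. An umbilic is a point where $\mathrm{II}$ is a multiple of the induced metric. *)

theory Defs
  imports "HOL-Analysis.Analysis"
begin

section \<open>Smooth surfaces\<close>

text \<open>Both notions are only used on open sets \<open>S\<close>.\<close>

primrec Ck_on :: "nat \<Rightarrow> ('a::real_normed_vector \<Rightarrow> 'b::real_normed_vector) \<Rightarrow> 'a set \<Rightarrow> bool" where
  "Ck_on 0 f S \<longleftrightarrow> continuous_on S f"
| "Ck_on (Suc k) f S \<longleftrightarrow>
     f differentiable_on S \<and> (\<forall>v. Ck_on k (\<lambda>x. frechet_derivative f (at x) v) S)"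

definition smooth_on :: "('a::real_normed_vector \<Rightarrow> 'b::real_normed_vector) \<Rightarrow> 'a set \<Rightarrow> bool" where
  "smooth_on f S \<longleftrightarrow> (\<forall>k. Ck_on k f S)"

type_synonym 'm chart = "'m set \<times> ('m \<Rightarrow> real^2)"

definition is_chart :: "'m topology \<Rightarrow> 'm chart \<Rightarrow> bool" where
  "is_chart M c \<longleftrightarrow> openin M (fst c) \<and> open (snd c ` fst c) \<and>
     homeomorphic_map (subtopology M (fst c)) (top_of_set (snd c ` fst c)) (snd c)"

definition in_chart :: "'m chart \<Rightarrow> ('m \<Rightarrow> 'b) \<Rightarrow> real^2 \<Rightarrow> 'b" where
  "in_chart c f = f \<circ> inv_into (fst c) (snd c)"

definition smooth_surface :: "'m topology \<Rightarrow> 'm chart set \<Rightarrow> bool" where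
  "smooth_surface M A \<longleftrightarrow> Hausdorff_space M \<and> second_countable M \<and>
     (\<forall>c\<in>A. is_chart M c) \<and> (\<Union>c\<in>A. fst c) = topspace M \<and>
     (\<forall>c\<in>A. \<forall>c'\<in>A. smooth_on (in_chart c (snd c')) (snd c ` (fst c \<inter> fst c')))"

definition smooth_map_on :: "'m chart set \<Rightarrow> 'm set \<Rightarrow> ('m \<Rightarrow> 'b::real_normed_vector) \<Rightarrow> bool" where
  "smooth_map_on A S f \<longleftrightarrow> (\<forall>c\<in>A. smooth_on (in_chart c f) (snd c ` (fst c \<inter> S)))"

text \<open>A tangent vector at a point \<open>p\<close> of the domain of a chart \<open>c\<close> is represented by its
  coordinate vector \<open>v\<close> in that chart; \<open>diff_map c f p v\<close> is the differential of \<open>f\<close> at \<open>p\<close>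
  applied to it, and \<open>diff2_map c f p v w\<close> is the derivative at \<open>p\<close> in direction \<open>v\<close> of
  \<open>df(w)\<close>, where \<open>w\<close> is extended as the vector field with constant coordinates.\<close>

definition diff_map :: "'m chart \<Rightarrow> ('m \<Rightarrow> 'b::real_normed_vector) \<Rightarrow> 'm \<Rightarrow> real^2 \<Rightarrow> 'b" where
  "diff_map c f p v = frechet_derivative (in_chart c f) (at (snd c p)) v"

definition diff2_map ::
  "'m chart \<Rightarrow> ('m \<Rightarrow> 'b::real_normed_vector) \<Rightarrow> 'm \<Rightarrow> real^2 \<Rightarrow> real^2 \<Rightarrow> 'b" where
  "diff2_map c f p v w =
     frechet_derivative (\<lambda>x. frechet_derivative (in_chart c f) (at x) w) (at (snd c p)) v"


section \<open>Minkowski models and surfaces in them\<close>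

text \<open>The index type \<open>4\<close> has the elements 0, 1, 2, 3 (with \<open>4 = 0\<close>), and the index type \<open>3\<close>
  has the elements 1, 2, 3 (with \<open>3 = 0\<close>).\<close>

definition mink :: "real^4 \<Rightarrow> real^4 \<Rightarrow> real" where
  "mink V W = - V$0 * W$0 + V$1 * W$1 + V$2 * W$2 + V$3 * W$3"

definition lor3 :: "real^3 \<Rightarrow> real^3 \<Rightarrow> real" where
  "lor3 v w = v$1 * w$1 + v$2 * w$2 - v$3 * w$3"

definition H3 :: "(real^4) set" where
  "H3 = {V. mink V V = -1 \<and> V$0 > 0}"

definition S13 :: "(real^4) set" where
  "S13 = {V. mink V V = 1}"

definition immersed_in :: "'m topology \<Rightarrow> 'm chart set \<Rightarrow> (real^4) set \<Rightarrow> ('m \<Rightarrow> real^4) \<Rightarrow> bool" where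
  "immersed_in M A Q F \<longleftrightarrow> F ` topspace M \<subseteq> Q \<and> smooth_map_on A (topspace M) F \<and>
     (\<forall>c\<in>A. \<forall>p\<in>fst c. inj (diff_map c F p))"

definition first_form :: "'m chart \<Rightarrow> ('m \<Rightarrow> real^4) \<Rightarrow> 'm \<Rightarrow> real^2 \<Rightarrow> real^2 \<Rightarrow> real" where
  "first_form c F p v w = mink (diff_map c F p v) (diff_map c F p w)"

definition spacelike :: "'m chart set \<Rightarrow> ('m \<Rightarrow> real^4) \<Rightarrow> bool" where
  "spacelike A F \<longleftrightarrow> (\<forall>c\<in>A. \<forall>p\<in>fst c. \<forall>v. v \<noteq> 0 \<longrightarrow> first_form c F p v v > 0)"

text \<open>\<open>G\<close> is a unit normal of \<open>F\<close> tangent to the ambient quadric containing \<open>F\<close>,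
  translated to the origin and regarded as a map into \<open>Q\<close>; it is space-like for \<open>Q = S13\<close> and
  time-like for \<open>Q = H3\<close>.\<close>

definition generalized_gauss_map ::
  "'m topology \<Rightarrow> 'm chart set \<Rightarrow> (real^4) set \<Rightarrow> ('m \<Rightarrow> real^4) \<Rightarrow> ('m \<Rightarrow> real^4) \<Rightarrow> bool" where
  "generalized_gauss_map M A Q F G \<longleftrightarrow> G ` topspace M \<subseteq> Q \<and> smooth_map_on A (topspace M) G \<and>
     (\<forall>p\<in>topspace M. mink (G p) (F p) = 0) \<and>
     (\<forall>c\<in>A. \<forall>p\<in>fst c. \<forall>v. mink (G p) (diff_map c F p v) = 0)"

text \<open>The Levi-Civita connection of \<open>H3\<close> and \<open>S13\<close> is the flat derivative of the ambient
  Minkowski space followed by the orthogonal projection along the position vector.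
  \<open>ambient_cov\<close> is \<open>D\<^sub>v (dF(w))\<close> for the constant coordinate fields \<open>v\<close> and \<open>w\<close>.\<close>

definition ambient_cov :: "'m chart \<Rightarrow> ('m \<Rightarrow> real^4) \<Rightarrow> 'm \<Rightarrow> real^2 \<Rightarrow> real^2 \<Rightarrow> real^4" where
  "ambient_cov c F p v w = diff2_map c F p v w
     - (mink (diff2_map c F p v w) (F p) / mink (F p) (F p)) *\<^sub>R F p"

text \<open>The coefficient of the normal in \<open>D\<^sub>Y Z = \<nabla>\<^sub>Y Z + II(Y,Z) \<nu>\<close>, with \<open>\<nabla>\<^sub>Y Z\<close> tangent to
  the surface.\<close>

definition second_form ::
  "'m chart \<Rightarrow> ('m \<Rightarrow> real^4) \<Rightarrow> ('m \<Rightarrow> real^4) \<Rightarrow> 'm \<Rightarrow> real^2 \<Rightarrow> real^2 \<Rightarrow> real" where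
  "second_form c F \<nu> p v w =
     (THE h. ambient_cov c F p v w - h *\<^sub>R \<nu> p \<in> range (diff_map c F p))"

definition umbilic :: "'m chart set \<Rightarrow> ('m \<Rightarrow> real^4) \<Rightarrow> ('m \<Rightarrow> real^4) \<Rightarrow> 'm \<Rightarrow> bool" where
  "umbilic A F \<nu> p \<longleftrightarrow> (\<exists>r. \<forall>c\<in>A. p \<in> fst c \<longrightarrow>
     (\<forall>v w. second_form c F \<nu> p v w = r * first_form c F p v w))"


section \<open>Gauss curvature and volume element\<close>

definition metric_in_chart :: "'m chart \<Rightarrow> ('m \<Rightarrow> real^4) \<Rightarrow> real^2 \<Rightarrow> real^2^2" where
  "metric_in_chart c F x = (\<chi> i j. mink (frechet_derivative (in_chart c F) (at x) (axis i 1))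
                                       (frechet_derivative (in_chart c F) (at x) (axis j 1)))"

definition partial :: "2 \<Rightarrow> (real^2 \<Rightarrow> real) \<Rightarrow> real^2 \<Rightarrow> real" where
  "partial i f x = frechet_derivative f (at x) (axis i 1)"

definition christoffel :: "(real^2 \<Rightarrow> real^2^2) \<Rightarrow> 2 \<Rightarrow> 2 \<Rightarrow> 2 \<Rightarrow> real^2 \<Rightarrow> real" where
  "christoffel g k i j x = (1/2) * (\<Sum>l\<in>UNIV. matrix_inv (g x) $ k $ l *
     (partial i (\<lambda>y. g y $ j $ l) x + partial j (\<lambda>y. g y $ i $ l) x - partial l (\<lambda>y. g y $ i $ j) x))"

text \<open>The \<open>l\<close>-th component of \<open>\<nabla>\<^sub>1 \<nabla>\<^sub>2 \<partial>\<^sub>2 - \<nabla>\<^sub>2 \<nabla>\<^sub>1 \<partial>\<^sub>2\<close>.\<close>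

definition curv_component :: "(real^2 \<Rightarrow> real^2^2) \<Rightarrow> 2 \<Rightarrow> real^2 \<Rightarrow> real" where
  "curv_component g l x =
     partial 1 (christoffel g l 2 2) x - partial 2 (christoffel g l 1 2) x
     + (\<Sum>m\<in>UNIV. christoffel g m 2 2 x * christoffel g l 1 m x
                - christoffel g m 1 2 x * christoffel g l 2 m x)"

definition sectional_curvature :: "(real^2 \<Rightarrow> real^2^2) \<Rightarrow> real^2 \<Rightarrow> real" where
  "sectional_curvature g x = (\<Sum>l\<in>UNIV. curv_component g l x * g x $ l $ 1) / det (g x)"

definition gauss_curvature :: "'m chart \<Rightarrow> ('m \<Rightarrow> real^4) \<Rightarrow> 'm \<Rightarrow> real" where
  "gauss_curvature c F p = sectional_curvature (metric_in_chart c F) (snd c p)"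

text \<open>The coefficient of the volume element with respect to \<open>du\<^sub>1 du\<^sub>2\<close> in the chart.\<close>

definition volume_density :: "'m chart \<Rightarrow> ('m \<Rightarrow> real^4) \<Rightarrow> 'm \<Rightarrow> real" where
  "volume_density c F p = sqrt (det (metric_in_chart c F (snd c p)))"


section \<open>Upper half-space models and the normal Gauss map\<close>

definition S_minus :: "(real^4) set" where
  "S_minus = {V \<in> S13. V$0 - V$3 < 0}"

definition S_plus :: "(real^4) set" where
  "S_plus = {V \<in> S13. V$0 - V$3 > 0}"

definition half_space_H :: "real^4 \<Rightarrow> real^3" where
  "half_space_H V = vector [V$1 / (V$0 - V$3), V$2 / (V$0 - V$3), 1 / (V$0 - V$3)]"

definition half_space_S :: "real^4 \<Rightarrow> real^3" where
  "half_space_S V = vector [V$1 / \<bar>V$0 - V$3\<bar>, V$2 / \<bar>V$0 - V$3\<bar>, 1 / \<bar>V$0 - V$3\<bar>]"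

text \<open>If \<open>\<Phi>\<close> is the identification with the upper half-space, the image of the unit normal under
  \<open>d\<Phi>\<close> is \<open>\<Sum>\<^sub>A x\<^sub>3 \<eta>\<^sub>A \<partial>/\<partial>x\<^sub>A\<close>, where \<open>x\<^sub>3\<close> is the third coordinate of the image point.\<close>

definition normal_gauss_map ::
  "(real^4 \<Rightarrow> real^3) \<Rightarrow> ('m \<Rightarrow> real^4) \<Rightarrow> ('m \<Rightarrow> real^4) \<Rightarrow> 'm \<Rightarrow> real^3" where
  "normal_gauss_map \<Phi> F \<nu> p =
     (1 / (\<Phi> (F p) $ 3)) *\<^sub>R frechet_derivative \<Phi> (at (F p)) (\<nu> p)"

definition fourth_form ::
  "(real^3 \<Rightarrow> real^3 \<Rightarrow> real) \<Rightarrow> 'm chart \<Rightarrow> ('m \<Rightarrow> real^3) \<Rightarrow> 'm \<Rightarrow> real^2 \<Rightarrow> real^2 \<Rightarrow> real" where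
  "fourth_form b c \<eta> p v w = b (diff_map c \<eta> p v) (diff_map c \<eta> p w)"

text \<open>\<open>S\<close> is the open set on which the normal Gauss map is considered.\<close>

definition normal_gauss_conformal ::
  "'m chart set \<Rightarrow> 'm set \<Rightarrow> (real^3 \<Rightarrow> real^3 \<Rightarrow> real) \<Rightarrow> (real^4 \<Rightarrow> real^3) \<Rightarrow>
     ('m \<Rightarrow> real^4) \<Rightarrow> ('m \<Rightarrow> real^4) \<Rightarrow> bool" where
  "normal_gauss_conformal A S b \<Phi> F \<nu> \<longleftrightarrow>
     (\<exists>\<rho> :: 'm \<Rightarrow> real. smooth_map_on A S \<rho> \<and>
        (\<forall>c\<in>A. \<forall>p\<in>fst c \<inter> S. \<forall>v w.
           fourth_form b c (normal_gauss_map \<Phi> F \<nu>) p v w = \<rho> p * second_form c F \<nu> p v w))"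

definition conformal_in_H3 ::
  "'m topology \<Rightarrow> 'm chart set \<Rightarrow> ('m \<Rightarrow> real^4) \<Rightarrow> ('m \<Rightarrow> real^4) \<Rightarrow> bool" where
  "conformal_in_H3 M A X \<nu> \<longleftrightarrow>
     normal_gauss_conformal A (topspace M) (\<lambda>v w. v \<bullet> w) half_space_H X \<nu>"

definition conformal_in_S13 ::
  "'m topology \<Rightarrow> 'm chart set \<Rightarrow> ('m \<Rightarrow> real^4) \<Rightarrow> ('m \<Rightarrow> real^4) \<Rightarrow> bool" where
  "conformal_in_S13 M A Y \<nu> \<longleftrightarrow>
     normal_gauss_conformal A {p \<in> topspace M. Y p \<in> S_minus \<union> S_plus} lor3 half_space_S Y \<nu>"

end

theory Submission
  imports Defs
begin

text \<open>
  Put \<open>u = (N\<^sub>0 - N\<^sub>3) / (X\<^sub>0 - X\<^sub>3)\<close>. The vector \<open>N - u X\<close> is orthogonal to the null vector \<open>(1,0,0,1)\<close>,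
  and reading off the normal Gauss map from it gives
  \<open>IV\<^sub>X = \<langle>dN - u dX, dN - u dX\<rangle>\<close>. Exchanging the roles of \<open>X\<close> and \<open>N\<close> replaces \<open>u\<close> by \<open>1/u\<close>, so that
  \<open>IV\<^sub>N = IV\<^sub>X / u\<^sup>2\<close> where \<open>u \<noteq> 0\<close>, while \<open>II\<^sub>N = - II\<^sub>X\<close>. Let \<open>s\<close> be the determinant of the shape
  operator of \<open>X\<close>; it does not vanish because \<open>N\<close> is an immersion. By Cayley--Hamilton
  \<open>IV\<^sub>X\<close> differs from \<open>(u\<^sup>2 - s) I\<^sub>X\<close> by a multiple of \<open>II\<^sub>X\<close>, so at a point that is not an umbilic,
  conformality means \<open>s = u\<^sup>2\<close>. Since \<open>I\<^sub>N\<close> has determinant \<open>s\<^sup>2\<close> times that of \<open>I\<^sub>X\<close>, this yields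
  the formula for the volume elements. If the normal Gauss map of \<open>N\<close> is conformal, then \<open>s = u\<^sup>2\<close>
  on the dense set \<open>u \<noteq> 0\<close>, hence everywhere by continuity, and then \<open>s \<noteq> 0\<close> forces \<open>u \<noteq> 0\<close>
  everywhere.
\<close>

section \<open>Smooth functions\<close>

lemma has_derivative_frechet_on_open:
  assumes "f differentiable_on S" "open S" "x \<in> S"
  shows "(f has_derivative frechet_derivative f (at x)) (at x)"
  using assms by (metis at_within_open differentiable_on_def frechet_derivative_works)

lemma frechet_derivative_eqI: "(f has_derivative f') (at x) \<Longrightarrow> frechet_derivative f (at x) = f'"
  using frechet_derivative_at by metis

lemma frechet_derivative_cong_open:
  assumes "open S" "x \<in> S" "\<And>y. y \<in> S \<Longrightarrow> f y = g y"
  shows "frechet_derivative f (at x) = frechet_derivative g (at x)"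
proof -
  have "(f has_derivative D) (at x) \<longleftrightarrow> (g has_derivative D) (at x)" for D
    using has_derivative_transform_within_open[of f D x UNIV S g]
      has_derivative_transform_within_open[of g D x UNIV S f] assms by auto
  then show ?thesis by (simp add: frechet_derivative_def)
qed

text \<open>\<open>frechet_derivative\<close> is taken at \<open>at x\<close>, so it only sees
  germs. Openness of \<open>S\<close> is what lets equality on \<open>S\<close> pass to the
  derivatives in the induction.\<close>

lemma Ck_on_cong:
  assumes "open S" "Ck_on k f S" "\<And>x. x \<in> S \<Longrightarrow> f x = g x"
  shows "Ck_on k g S"
  using assms(2,3)
proof (induction k arbitrary: f g)
  case 0
  then show ?case by (simp cong: continuous_on_cong)
next
  case (Suc k)
  have "Ck_on k (\<lambda>x. frechet_derivative g (at x) v) S" for v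
  proof (rule Suc.IH)
    show "Ck_on k (\<lambda>x. frechet_derivative f (at x) v) S" using Suc.prems(1) by simp
    show "frechet_derivative f (at x) v = frechet_derivative g (at x) v" if "x \<in> S" for x
      by (simp add: frechet_derivative_cong_open[OF assms(1) that Suc.prems(2)])
  qed
  moreover have "g differentiable_on S"
    unfolding differentiable_on_def
  proof
    fix x assume x: "x \<in> S"
    then have "f differentiable (at x within S)"
      using Suc.prems(1) by (simp add: differentiable_on_def)
    then show "g differentiable (at x within S)"
      by (rule differentiable_transform_within[OF _ zero_less_one x]) (simp add: Suc.prems(2))
  qed
  ultimately show ?case by simp
qed

lemma Ck_on_subset: "Ck_on k f S \<Longrightarrow> T \<subseteq> S \<Longrightarrow> Ck_on k f T"
  by (induction k arbitrary: f) (auto intro: continuous_on_subset differentiable_on_subset)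

lemma Ck_on_Suc_imp: "Ck_on (Suc k) f S \<Longrightarrow> Ck_on k f S"
  by (induction k arbitrary: f) (auto intro: differentiable_imp_continuous_on)

lemma Ck_on_bounded_linear:
  assumes "bounded_linear L" "open S" "Ck_on k f S"
  shows "Ck_on k (\<lambda>x. L (f x)) S"
  using assms(3)
proof (induction k arbitrary: f)
  case 0
  then show ?case by (simp add: bounded_linear.continuous_on[OF assms(1)])
next
  case (Suc k)
  have d: "((\<lambda>x. L (f x)) has_derivative (\<lambda>v. L (frechet_derivative f (at x) v))) (at x)" if "x \<in> S" for x
    using Suc.prems that assms
    by (auto intro!: bounded_linear.has_derivative[OF assms(1)] has_derivative_frechet_on_open)
  have "Ck_on k (\<lambda>x. frechet_derivative (\<lambda>x. L (f x)) (at x) v) S" for v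
    by (rule Ck_on_cong[OF assms(2) Suc.IH[of "\<lambda>x. frechet_derivative f (at x) v"]])
      (use Suc.prems frechet_derivative_eqI[OF d] in auto)
  moreover have "(\<lambda>x. L (f x)) differentiable_on S"
    using d by (auto simp: differentiable_on_def intro: differentiableI differentiable_at_withinI)
  ultimately show ?case by simp
qed

lemma Ck_on_add:
  assumes "open S" "Ck_on k f S" "Ck_on k g S"
  shows "Ck_on k (\<lambda>x. f x + g x) S"
  using assms(2,3)
proof (induction k arbitrary: f g)
  case 0
  then show ?case by (simp add: continuous_on_add)
next
  case (Suc k)
  have d: "((\<lambda>x. f x + g x) has_derivative
      (\<lambda>v. frechet_derivative f (at x) v + frechet_derivative g (at x) v)) (at x)" if "x \<in> S" for x
    using Suc.prems that assms
    by (auto intro!: has_derivative_add has_derivative_frechet_on_open)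
  have "Ck_on k (\<lambda>x. frechet_derivative (\<lambda>x. f x + g x) (at x) v) S" for v
    by (rule Ck_on_cong[OF assms(1) Suc.IH[of "\<lambda>x. frechet_derivative f (at x) v"
            "\<lambda>x. frechet_derivative g (at x) v"]])
      (use Suc.prems frechet_derivative_eqI[OF d] in auto)
  then show ?case using Suc.prems by (simp add: differentiable_on_add)
qed

text \<open>Leibniz rule and induction. Each product keeps one factor undifferentiated, and
  \<open>Ck_on_Suc_imp\<close> lowers the order of that factor to fit the induction
  hypothesis.\<close>

lemma Ck_on_mult:
  fixes f g :: "'a::real_normed_vector \<Rightarrow> real"
  assumes "open S" "Ck_on k f S" "Ck_on k g S"
  shows "Ck_on k (\<lambda>x. f x * g x) S"
  using assms(2,3)
proof (induction k arbitrary: f g)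
  case 0
  then show ?case by (simp add: continuous_on_mult)
next
  case (Suc k)
  have d: "((\<lambda>x. f x * g x) has_derivative
      (\<lambda>v. f x * frechet_derivative g (at x) v + frechet_derivative f (at x) v * g x)) (at x)"
    if "x \<in> S" for x
    using Suc.prems that assms
    by (auto intro!: has_derivative_mult has_derivative_frechet_on_open)
  have "Ck_on k (\<lambda>x. frechet_derivative (\<lambda>x. f x * g x) (at x) v) S" for v
  proof (rule Ck_on_cong[OF assms(1)])
    show "Ck_on k (\<lambda>x. f x * frechet_derivative g (at x) v + frechet_derivative f (at x) v * g x) S"
      using Suc.prems Ck_on_Suc_imp[OF Suc.prems(1)] Ck_on_Suc_imp[OF Suc.prems(2)]
      by (intro Ck_on_add[OF assms(1)] Suc.IH) auto
  qed (simp add: frechet_derivative_eqI[OF d])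
  then show ?case using Suc.prems by (simp add: differentiable_on_mult)
qed

text \<open>The derivative of \<open>1/f\<close> is \<open>- f'/f^2\<close>, a product of functions
  already known to be of class \<open>k\<close>.\<close>

lemma Ck_on_inverse:
  fixes f :: "'a::real_normed_vector \<Rightarrow> real"
  assumes "open S" "\<And>x. x \<in> S \<Longrightarrow> f x \<noteq> 0" "Ck_on k f S"
  shows "Ck_on k (\<lambda>x. inverse (f x)) S"
  using assms(3)
proof (induction k)
  case 0
  then show ?case using assms(2) by (simp add: continuous_on_inverse)
next
  case (Suc k)
  have d: "((\<lambda>x. inverse (f x)) has_derivative
      (\<lambda>v. - (inverse (f x) * frechet_derivative f (at x) v * inverse (f x)))) (at x)"
    if "x \<in> S" for x
    using Suc.prems that assms(1)
    by (intro Deriv.has_derivative_inverse assms(2) has_derivative_frechet_on_open[of f S]) auto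
  have *: "Ck_on k (\<lambda>x. inverse (f x)) S"
    using Suc.IH Ck_on_Suc_imp[OF Suc.prems] by blast
  have "Ck_on k (\<lambda>x. frechet_derivative (\<lambda>x. inverse (f x)) (at x) v) S" for v
  proof (rule Ck_on_cong[OF assms(1)])
    show "Ck_on k (\<lambda>x. - (inverse (f x) * frechet_derivative f (at x) v * inverse (f x))) S"
      using Suc.prems
      by (intro Ck_on_bounded_linear[OF bounded_linear_minus[OF bounded_linear_ident] assms(1)]
           Ck_on_mult[OF assms(1)] *) auto
  qed (simp add: frechet_derivative_eqI[OF d])
  moreover have "(\<lambda>x. inverse (f x)) differentiable_on S"
    using d by (auto simp: differentiable_on_def intro: differentiableI differentiable_at_withinI)
  ultimately show ?case by simp
qed

text \<open>Passing from one surface to the other multiplies the conformal factor by minus the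
  square of a quotient of null coordinates; \<open>L\<close> will be
  \<open>null_coord\<close>.\<close>

lemma smooth_map_on_rescale:
  fixes r :: "'m \<Rightarrow> real" and F G :: "'m \<Rightarrow> 'b::real_normed_vector"
  assumes L: "bounded_linear (L :: 'b \<Rightarrow> real)"
    and op: "\<And>c. c \<in> A \<Longrightarrow> open (snd c ` (fst c \<inter> S))"
    and ch: "\<And>c. c \<in> A \<Longrightarrow> inj_on (snd c) (fst c)"
    and ST: "S \<subseteq> T" and nz: "\<And>p. p \<in> S \<Longrightarrow> L (G p) \<noteq> 0"
    and r: "smooth_map_on A S r" and F: "smooth_map_on A T F" and G: "smooth_map_on A T G"
  shows "smooth_map_on A S (\<lambda>p. - (r p * (L (F p) / L (G p))\<^sup>2))"
  unfolding smooth_map_on_def smooth_on_def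
proof (intro ballI allI)
  fix c k assume c: "c \<in> A"
  let ?O = "snd c ` (fst c \<inter> S)"
  note o = op[OF c]
  have sub: "?O \<subseteq> snd c ` (fst c \<inter> T)" using ST by blast
  have 1: "Ck_on k (in_chart c r) ?O" "Ck_on k (in_chart c F) ?O" "Ck_on k (in_chart c G) ?O"
    using r F G c unfolding smooth_map_on_def smooth_on_def by (blast intro: Ck_on_subset[OF _ sub])+
  have 2: "L (in_chart c G y) \<noteq> 0" if "y \<in> ?O" for y
    using that nz ch[OF c] by (auto simp: in_chart_def)
  let ?q = "\<lambda>y. L (in_chart c F y) * inverse (L (in_chart c G y))"
  have q: "Ck_on k ?q ?O"
    by (intro Ck_on_mult[OF o] Ck_on_inverse[OF o 2] Ck_on_bounded_linear[OF L o] 1)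
  have "Ck_on k (\<lambda>y. - (in_chart c r y * (?q y * ?q y))) ?O"
    by (rule Ck_on_bounded_linear[OF bounded_linear_minus[OF bounded_linear_ident] o])
      (intro Ck_on_mult[OF o] q 1)
  then show "Ck_on k (in_chart c (\<lambda>p. - (r p * (L (F p) / L (G p))\<^sup>2))) ?O"
    by (rule Ck_on_cong[OF o]) (simp add: in_chart_def power2_eq_square divide_inverse)
qed

section \<open>Linear algebra in Minkowski space\<close>

lemma mink_add_left: "mink (a + b) c = mink a c + mink b c"
  and mink_add_right: "mink a (b + c) = mink a b + mink a c"
  and mink_diff_left: "mink (a - b) c = mink a c - mink b c"
  and mink_diff_right: "mink a (b - c) = mink a b - mink a c"
  and mink_scaleR_left: "mink (k *\<^sub>R a) b = k * mink a b"
  and mink_scaleR_right: "mink a (k *\<^sub>R b) = k * mink a b"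
  and mink_minus_left: "mink (- a) b = - mink a b"
  and mink_minus_right: "mink a (- b) = - mink a b"
  and mink_zero_left: "mink 0 b = 0"
  and mink_zero_right: "mink a 0 = 0"
  by (auto simp: mink_def algebra_simps)

lemmas mink_simps = mink_add_left mink_add_right mink_diff_left mink_diff_right
  mink_scaleR_left mink_scaleR_right mink_minus_left mink_minus_right mink_zero_left mink_zero_right

lemma mink_commute: "mink a b = mink b a"
  by (simp add: mink_def mult.commute)

lemma vec4_eq_iff: "a = (b :: 'a^4) \<longleftrightarrow> a$0 = b$0 \<and> a$1 = b$1 \<and> a$2 = b$2 \<and> a$3 = b$3"
proof -
  have four: "(4::4) = 0" by simp
  show ?thesis by (auto simp: vec_eq_iff forall_4 four)
qed

text \<open>The orthogonal complement of a time-like vector is space-like. The proof is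
  Cauchy-Schwarz for the spatial parts of \<open>X\<close> and \<open>Y\<close>.\<close>

lemma null_orthogonal_timelike_eq_0:
  assumes "mink X X = -1" "mink X Y = 0" "mink Y Y = 0"
  shows "Y = 0"
proof -
  have x: "(X$0)\<^sup>2 = 1 + ((X$1)\<^sup>2 + (X$2)\<^sup>2 + (X$3)\<^sup>2)"
    and y: "X$0 * Y$0 = X$1 * Y$1 + X$2 * Y$2 + X$3 * Y$3"
    using assms by (auto simp: mink_def power2_eq_square)
  let ?S = "(Y$1)\<^sup>2 + (Y$2)\<^sup>2 + (Y$3)\<^sup>2"
  have "(X$0 * Y$0)\<^sup>2 \<le> ((X$1)\<^sup>2 + (X$2)\<^sup>2 + (X$3)\<^sup>2) * ?S"
  proof -
    \<comment> \<open>Lagrange's identity: the Cauchy-Schwarz defect is the squared norm of the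
      cross product.\<close>
    have "((X$1)\<^sup>2 + (X$2)\<^sup>2 + (X$3)\<^sup>2) * ?S - (X$1 * Y$1 + X$2 * Y$2 + X$3 * Y$3)\<^sup>2
      = (X$1 * Y$2 - X$2 * Y$1)\<^sup>2 + (X$1 * Y$3 - X$3 * Y$1)\<^sup>2 + (X$2 * Y$3 - X$3 * Y$2)\<^sup>2"
      by (simp add: power2_eq_square algebra_simps)
    then show ?thesis unfolding y
      by (smt (verit) zero_le_power2)
  qed
  then have "(X$0)\<^sup>2 * (Y$0)\<^sup>2 \<le> ((X$0)\<^sup>2 - 1) * ?S"
    using x by (simp add: power_mult_distrib)
  then have "?S \<le> (X$0)\<^sup>2 * mink Y Y"
    by (simp add: mink_def power2_eq_square algebra_simps)
  then have "?S \<le> 0" using assms(3) by simp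
  then have "Y$1 = 0 \<and> Y$2 = 0 \<and> Y$3 = 0"
    by (smt (verit) zero_le_power2 power2_less_eq_zero_iff)
  then show "Y = 0" using assms(3) by (simp add: mink_def vec4_eq_iff)
qed

lemma linear_real2:
  assumes "linear (P :: real^2 \<Rightarrow> 'a::real_vector)"
  shows "P v = v$1 *\<^sub>R P (axis 1 1) + v$2 *\<^sub>R P (axis 2 1)"
proof -
  have "v = v$1 *\<^sub>R axis 1 1 + v$2 *\<^sub>R axis 2 1"
    by (simp add: vec_eq_iff forall_2 axis_def)
  then have "P v = P (v$1 *\<^sub>R axis 1 1 + v$2 *\<^sub>R axis 2 1)" by simp
  then show ?thesis by (simp only: linear_add[OF assms] linear_scale[OF assms])
qed

text \<open>\<open>X\<close>, \<open>N\<close> and the image of \<open>P\<close> are mutually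
  orthogonal, with \<open>X\<close> and \<open>N\<close> not null, so the map \<open>T\<close> from
  coefficients to vectors is injective, hence onto by dimension.\<close>

lemma mink_frame_decomposition:
  fixes P :: "real^2 \<Rightarrow> real^4"
  assumes "linear P" "inj P"
    and "mink X X \<noteq> 0" "mink N N \<noteq> 0" "mink N X = 0"
    and "\<And>v. mink X (P v) = 0" "\<And>v. mink N (P v) = 0"
  obtains a b v where "W = a *\<^sub>R X + b *\<^sub>R N + P v"
proof -
  define T :: "real^4 \<Rightarrow> real^4" where
    "T c = c$0 *\<^sub>R X + c$1 *\<^sub>R N + P (vector [c$2, c$3])" for c
  have P: "P (vector [a, b]) = a *\<^sub>R P (axis 1 1) + b *\<^sub>R P (axis 2 1)" for a b
    by (subst linear_real2[OF assms(1)]) simp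
  have lin: "linear T"
    by (rule linearI) (simp_all add: T_def P algebra_simps)
  have "c = 0" if "T c = 0" for c
  proof -
    have "mink X (T c) = 0" "mink N (T c) = 0" using that by (simp_all add: mink_simps)
    then have c: "c$0 = 0" "c$1 = 0"
      using assms(3-7) by (simp_all add: T_def mink_simps mink_commute[of X N])
    then have "P (vector [c$2, c$3]) = 0" using that by (simp add: T_def)
    then have "(vector [c$2, c$3] :: real^2) = 0"
      using assms(1,2) by (metis linear_injective_0)
    then have "c$2 = 0 \<and> c$3 = 0" by (metis vector_2 zero_index)
    then show ?thesis using c by (simp add: vec4_eq_iff)
  qed
  then have "inj T" using lin linear_injective_0 by blast
  then have "surj T" using lin linear_injective_imp_surjective by blast
  then obtain c where "W = T c" by (meson surjD)
  then show thesis using that by (simp add: T_def)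
qed

text \<open>Expand \<open>L\<close> in the frame of \<open>X\<close>, \<open>N\<close> and the plane
  of \<open>Q\<close>. Pairing with \<open>N\<close> and with the positive definite plane leaves a
  multiple of the time-like \<open>X\<close>, and this is null only if it vanishes.\<close>

lemma null_vector_not_orthogonal:
  fixes Q :: "real^2 \<Rightarrow> real^4"
  assumes "linear Q" "inj Q"
    and "mink X X = -1" "mink N N = 1" "mink N X = 0"
    and "\<And>v. mink X (Q v) = 0" "\<And>v. mink N (Q v) = 0"
    and pos: "\<And>v. v \<noteq> 0 \<Longrightarrow> mink (Q v) (Q v) > 0"
    and L: "mink L L = 0" "mink L N = 0" "\<And>v. mink L (Q v) = 0"
  shows "L = 0"
proof -
  obtain a b v where d: "L = a *\<^sub>R X + b *\<^sub>R N + Q v"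
    by (rule mink_frame_decomposition[of Q X N L]) (use assms in auto)
  have b: "b = 0" using L(2) assms unfolding d
    by (simp add: mink_simps mink_commute[of X N] mink_commute[of "Q v" N])
  have "mink (Q v) (Q v) = 0" using L(3)[of v] assms b unfolding d
    by (simp add: mink_simps)
  then have v: "v = 0" using pos[of v] by auto
  have "Q v = 0" using v assms(1) linear_0 by blast
  then show ?thesis using L(1) b assms(3) unfolding d by (simp add: mink_simps)
qed

text \<open>The situation at one point: \<open>P\<close> and \<open>Q\<close> are the differentials
  of the two surfaces in a chart, and \<open>pos\<close> says that the second surface is
  space-like.\<close>

locale gauss_pair =
  fixes X N :: "real^4" and P Q :: "real^2 \<Rightarrow> real^4"
  assumes linear: "linear P" "linear Q"
    and inj: "inj P"
    and XX: "mink X X = -1" and NN: "mink N N = 1" and NX: "mink N X = 0"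
    and XP: "\<And>v. mink X (P v) = 0" and NP: "\<And>v. mink N (P v) = 0"
    and XQ: "\<And>v. mink X (Q v) = 0" and NQ: "\<And>v. mink N (Q v) = 0"
    and pos: "\<And>v. v \<noteq> 0 \<Longrightarrow> mink (Q v) (Q v) > 0"
begin

text \<open>Weingarten: \<open>Q v\<close> is orthogonal to \<open>X\<close> and to
  \<open>N\<close>, which leaves only the tangential part. This makes the shape operator available
  as a matrix.\<close>

lemma gauss_map_in_range: "Q v \<in> range P"
proof -
  obtain a b w where d: "Q v = a *\<^sub>R X + b *\<^sub>R N + P w"
    by (rule mink_frame_decomposition[of P X N "Q v"])
      (use linear inj XX NN NX XP NP in auto)
  have "a = 0" using XQ[of v] XX NX XP unfolding d by (simp add: mink_simps mink_commute[of X N])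
  moreover have "b = 0" using NQ[of v] NN NX NP unfolding d by (simp add: mink_simps)
  ultimately show ?thesis using d by simp
qed

abbreviation "P1 \<equiv> P (axis 1 1)"
abbreviation "P2 \<equiv> P (axis 2 1)"
abbreviation "Q1 \<equiv> Q (axis 1 1)"
abbreviation "Q2 \<equiv> Q (axis 2 1)"

text \<open>Determinants of the three fundamental forms of \<open>X\<close>. The second form carries
  a minus sign, which drops out of a determinant of size two.\<close>

abbreviation "det_I \<equiv> mink P1 P1 * mink P2 P2 - mink P1 P2 * mink P2 P1"
abbreviation "det_II \<equiv> mink P1 Q1 * mink P2 Q2 - mink P2 Q1 * mink P1 Q2"
abbreviation "det_III \<equiv> mink Q1 Q1 * mink Q2 Q2 - mink Q1 Q2 * mink Q2 Q1"

lemma det_III_pos: "det_III > 0"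
proof -
  \<comment> \<open>The combination whose image under \<open>Q\<close> is orthogonal to
    \<open>Q2\<close>; its square is \<open>mink Q2 Q2\<close> times the Gram determinant.\<close>
  let ?v = "mink Q2 Q2 *\<^sub>R axis 1 1 - mink Q1 Q2 *\<^sub>R axis 2 1 :: real^2"
  have ne: "(axis 1 1 :: real^2) \<noteq> 0" "(axis 2 1 :: real^2) \<noteq> 0" by (simp_all add: axis_eq_0_iff)
  have q: "mink Q2 Q2 > 0" using pos ne by blast
  have "?v $ 1 \<noteq> 0" using q by (simp add: axis_def)
  then have "?v \<noteq> 0" by (metis zero_index)
  then have "mink (Q ?v) (Q ?v) > 0" by (rule pos)
  also have "mink (Q ?v) (Q ?v) = mink Q2 Q2 * det_III"
    by (simp add: linear_diff[OF linear(2)] linear_cmul[OF linear(2)] mink_simps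
        mink_commute[of Q2 Q1] algebra_simps)
  finally show ?thesis using q by (simp add: zero_less_mult_iff)
qed

lemma gauss_map_matrix:
  obtains p q r t where "Q1 = p *\<^sub>R P1 + q *\<^sub>R P2" "Q2 = r *\<^sub>R P1 + t *\<^sub>R P2"
proof -
  have "\<exists>a b. Q v = a *\<^sub>R P1 + b *\<^sub>R P2" for v
  proof -
    obtain w where "Q v = P w" using gauss_map_in_range by blast
    then show ?thesis using linear_real2[OF linear(1), of w] by metis
  qed
  then show thesis using that by meson
qed

text \<open>\<open>s\<close> is the determinant of the matrix that expresses \<open>Q1\<close>,
  \<open>Q2\<close> through \<open>P1\<close>, \<open>P2\<close>; it enters the second form once and
  the third form twice. Positivity of \<open>det_III\<close> excludes zero.\<close>

lemma det_relations:
  obtains s where "s \<noteq> 0" "det_I \<noteq> 0" "det_II = s * det_I" "det_III = s\<^sup>2 * det_I"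
proof -
  obtain p q r t where Q: "Q1 = p *\<^sub>R P1 + q *\<^sub>R P2" "Q2 = r *\<^sub>R P1 + t *\<^sub>R P2"
    by (rule gauss_map_matrix)
  let ?s = "p * t - q * r"
  have "det_II = ?s * det_I" "det_III = ?s\<^sup>2 * det_I"
    unfolding Q by (simp_all add: mink_simps mink_commute[of P2 P1] algebra_simps power2_eq_square)
  moreover from this have "?s \<noteq> 0" "det_I \<noteq> 0" using det_III_pos by auto
  ultimately show thesis using that by blast
qed

text \<open>Here \<open>u\<close> stands for the slope. Away from umbilics the first and second
  forms are not proportional, so the relation between them produced by Cayley-Hamilton must be
  trivial, and its first coefficient is \<open>u^2 - s\<close>.\<close>

lemma conformal_det:
  assumes conf: "\<And>v w. mink (Q v - u *\<^sub>R P v) (Q w - u *\<^sub>R P w) = \<rho> * - mink (P w) (Q v)"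
    and not_umb: "\<And>r. \<exists>v w. - mink (P w) (Q v) \<noteq> r * mink (P v) (P w)"
  shows "det_II = u\<^sup>2 * det_I" "det_III = u^4 * det_I" "u \<noteq> 0"
proof -
  have rho: "\<rho> \<noteq> 0"
  proof
    assume "\<rho> = 0"
    \<comment> \<open>With a zero factor \<open>Q v - u P v\<close> is null and orthogonal to the
      time-like \<open>X\<close>, hence zero; the shape operator is then scalar and the point
      umbilic.\<close>
    have Q: "Q v = u *\<^sub>R P v" for v
    proof -
      have "mink (Q v - u *\<^sub>R P v) (Q v - u *\<^sub>R P v) = 0" using conf \<open>\<rho> = 0\<close> by simp
      then have "Q v - u *\<^sub>R P v = 0"
        by (rule null_orthogonal_timelike_eq_0[OF XX, rotated]) (simp add: mink_simps XP XQ)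
      then show ?thesis by simp
    qed
    show False using not_umb[of "-u"] by (auto simp: Q mink_simps mink_commute)
  qed
  txt \<open>The fourth fundamental form is symmetric, so conformality makes the second one symmetric
    too; no commutation of partial derivatives is needed.\<close>
  have sym: "mink P2 Q1 = mink P1 Q2"
  proof -
    have "\<rho> * mink P2 Q1 = \<rho> * mink P1 Q2"
      using conf[of "axis 1 1" "axis 2 1"] conf[of "axis 2 1" "axis 1 1"]
      mink_commute[of "Q1 - u *\<^sub>R P1" "Q2 - u *\<^sub>R P2"] by linarith
    then show ?thesis using rho by simp
  qed
  obtain p q r t where Q: "Q1 = p *\<^sub>R P1 + q *\<^sub>R P2" "Q2 = r *\<^sub>R P1 + t *\<^sub>R P2"
    by (rule gauss_map_matrix)
  define E F G where EFG: "E = mink P1 P1" "F = mink P1 P2" "G = mink P2 P2"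
  let ?s = "p * t - q * r"
  \<comment> \<open>Collects all coefficients of \<open>mink (P w) (Q v)\<close>: the cross terms,
    the conformal factor and the trace from Cayley-Hamilton.\<close>
  let ?k = "2 * u - \<rho> - (p + t)"
  have F': "mink P2 P1 = F" by (simp add: EFG mink_commute)
  have m: "mink P1 Q1 = p * E + q * F" "mink P2 Q1 = p * F + q * G"
     "mink P1 Q2 = r * E + t * F" "mink P2 Q2 = r * F + t * G"
    unfolding Q by (simp_all add: mink_simps F' EFG[symmetric])
  have s2: "p * F + q * G = r * E + t * F" using sym m by simp
  have d: "det_II = ?s * det_I" "det_III = ?s\<^sup>2 * det_I"
    unfolding Q by (simp_all add: mink_simps mink_commute[of P2 P1] algebra_simps power2_eq_square)
  have det0: "E * G - F * F \<noteq> 0" "?s \<noteq> 0"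
    using d(2) det_III_pos by (auto simp: F' EFG[symmetric])
  txt \<open>Cayley--Hamilton for the shape operator: the third fundamental form is the trace times the
    second minus the determinant times the first.\<close>
  have c: "(u\<^sup>2 - ?s) * E = ?k * (p * E + q * F)" "(u\<^sup>2 - ?s) * F = ?k * (p * F + q * G)"
     "(u\<^sup>2 - ?s) * G = ?k * (r * F + t * G)"
    using conf[of "axis 1 1" "axis 1 1"] conf[of "axis 1 1" "axis 2 1"] conf[of "axis 2 1" "axis 2 1"] s2
    unfolding m unfolding Q by (simp_all add: mink_simps F' EFG[symmetric]) algebra+
  have "?s = u\<^sup>2"
  proof (rule ccontr)
    assume n: "?s \<noteq> u\<^sup>2"
    \<comment> \<open>Otherwise \<open>E\<close>, \<open>F\<close>, \<open>G\<close> would vanish,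
      against the nonzero determinant of the first form.\<close>
    have k: "?k \<noteq> 0" using c n det0 by auto
    define z where "z = (u\<^sup>2 - ?s) / ?k"
    have h: "mink P1 Q1 = z * E" "mink P2 Q1 = z * F" "mink P1 Q2 = z * F" "mink P2 Q2 = z * G"
      using c k unfolding m s2[symmetric] z_def by (simp_all add: field_simps)
    have "mink (P w) (Q v) = z * mink (P v) (P w)" for v w
      by (subst (1 2) linear_real2[OF linear(1), of w], subst linear_real2[OF linear(1), of v],
          subst linear_real2[OF linear(2), of v])
        (simp add: mink_simps h EFG[symmetric] F' algebra_simps)
    then show False using not_umb[of "-z"] by simp
  qed
  then show "det_II = u\<^sup>2 * det_I" "det_III = u^4 * det_I" "u \<noteq> 0"
    using d det0 by (auto simp: power2_eq_square power4_eq_xxxx)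
qed

end

section \<open>The normal Gauss map in Minkowski coordinates\<close>

lemma has_derivative_mink:
  assumes "(f has_derivative f') (at x)" "(g has_derivative g') (at x)"
  shows "((\<lambda>y. mink (f y) (g y)) has_derivative (\<lambda>v. mink (f' v) (g x) + mink (f x) (g' v))) (at x)"
proof -
  have [derivative_intros]: "((\<lambda>y. f y $ i) has_derivative (\<lambda>v. f' v $ i)) (at x)"
    "((\<lambda>y. g y $ i) has_derivative (\<lambda>v. g' v $ i)) (at x)" for i
    using assms by (auto intro: bounded_linear.has_derivative[OF bounded_linear_vec_nth])
  show ?thesis
    unfolding mink_def by (auto intro!: derivative_eq_intros simp: algebra_simps)
qed

text \<open>Used to differentiate the constraints: first the constant squares of \<open>X\<close>
  and \<open>N\<close>, then the orthogonality of the normal to the tangent vectors.\<close>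

lemma mink_constant_derivative:
  assumes "(f has_derivative f') (at x)" "(g has_derivative g') (at x)"
    and "open U" "x \<in> U" "\<And>y. y \<in> U \<Longrightarrow> mink (f y) (g y) = k"
  shows "mink (f' v) (g x) + mink (f x) (g' v) = 0"
proof -
  have "((\<lambda>y. mink (f y) (g y)) has_derivative (\<lambda>v. 0)) (at x)"
    by (rule has_derivative_transform_within_open[of "\<lambda>y. k" _ _ _ U]) (use assms(3-5) in auto)
  then have "(\<lambda>v. mink (f' v) (g x) + mink (f x) (g' v)) = (\<lambda>v. 0)"
    using has_derivative_mink[OF assms(1,2)] has_derivative_unique by blast
  then show ?thesis by meson
qed

lemma smooth_on_imp:
  assumes "smooth_on f S"
  shows "f differentiable_on S" "(\<lambda>x. frechet_derivative f (at x) v) differentiable_on S"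
proof -
  have "Ck_on (Suc (Suc 0)) f S" using assms by (simp add: smooth_on_def)
  then show "f differentiable_on S" "(\<lambda>x. frechet_derivative f (at x) v) differentiable_on S" by auto
qed

lemma has_derivative_vector_3:
  fixes a b c :: "'a::real_normed_vector \<Rightarrow> real"
  assumes "(a has_derivative a') F" "(b has_derivative b') F" "(c has_derivative c') F"
  shows "((\<lambda>x. vector [a x, b x, c x] :: real^3) has_derivative (\<lambda>h. vector [a' h, b' h, c' h])) F"
proof -
  have v: "vector [p, q, r] = p *\<^sub>R axis 1 1 + q *\<^sub>R axis 2 1 + r *\<^sub>R (axis 3 1 :: real^3)" for p q r :: real
    by (simp add: vec_eq_iff forall_3 axis_def)
  show ?thesis unfolding v
    by (intro has_derivative_add has_derivative_scaleR_left assms)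
qed

abbreviation (input) null_coord :: "real^4 \<Rightarrow> real" where
  "null_coord V \<equiv> V$0 - V$3"

lemma bounded_linear_null_coord: "bounded_linear null_coord"
  by (intro bounded_linear_sub bounded_linear_vec_nth)

lemmas has_derivative_component = bounded_linear.has_derivative[OF bounded_linear_vec_nth]

text \<open>\<open>null_coord\<close> is the reciprocal of the third half-space coordinate (up to sign in the de
  Sitter case), and \<open>gauss_vec V W\<close> is the normal Gauss map at position \<open>V\<close> with normal \<open>W\<close>, in
  both geometries.\<close>

definition gauss_vec :: "real^4 \<Rightarrow> real^4 \<Rightarrow> real^3" where
  "gauss_vec V W = vector [W$1 - null_coord W / null_coord V * V$1, W$2 - null_coord W / null_coord V * V$2,
     - (null_coord W / null_coord V)]"

text \<open>The quotient rule with \<open>1 / g x\<close> split off: for the half-space coordinates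
  this is, up to sign, the third coordinate, by which the normal Gauss map divides.\<close>

lemma has_derivative_quotient:
  fixes f g :: "'a::real_normed_vector \<Rightarrow> real"
  assumes "(f has_derivative f') (at x)" "(g has_derivative g') (at x)" "g x \<noteq> 0"
  shows "((\<lambda>y. f y / g y) has_derivative (\<lambda>h. (f' h - f x / g x * g' h) / g x)) (at x)"
proof -
  have "(\<lambda>h. (f' h * g x - f x * g' h) / (g x * g x)) = (\<lambda>h. (f' h - f x / g x * g' h) / g x)"
    using assms(3) by (intro ext) (simp add: field_simps)
  then show ?thesis using has_derivative_divide'[OF assms] by simp
qed

lemmas has_derivative_null_coord = bounded_linear.has_derivative[OF bounded_linear_null_coord]

lemma half_space_H_has_derivative:
  assumes "null_coord V \<noteq> 0"
  shows "(half_space_H has_derivative (\<lambda>h. (1 / null_coord V) *\<^sub>R gauss_vec V h)) (at V)"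
proof -
  have c: "((\<lambda>V. V$i / null_coord V) has_derivative
      (\<lambda>h. (h$i - V$i / null_coord V * null_coord h) / null_coord V)) (at V)" for i
    by (intro has_derivative_quotient has_derivative_component has_derivative_null_coord
        has_derivative_ident assms)
  have d: "((\<lambda>V. 1 / null_coord V) has_derivative (\<lambda>h. (0 - 1 / null_coord V * null_coord h) / null_coord V)) (at V)"
    by (intro has_derivative_quotient has_derivative_const has_derivative_null_coord
        has_derivative_ident assms)
  have e: "(1 / null_coord V) *\<^sub>R gauss_vec V h =
    vector [(h$1 - V$1 / null_coord V * null_coord h) / null_coord V,
       (h$2 - V$2 / null_coord V * null_coord h) / null_coord V, (0 - 1 / null_coord V * null_coord h) / null_coord V]" for h
    by (simp add: gauss_vec_def vec_eq_iff forall_3)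
  show ?thesis
    unfolding e half_space_H_def[abs_def] by (intro has_derivative_vector_3 c d)
qed

lemma normal_gauss_map_H:
  assumes "null_coord (F p) \<noteq> 0"
  shows "normal_gauss_map half_space_H F \<nu> p = gauss_vec (F p) (\<nu> p)"
  using assms frechet_derivative_eqI[OF half_space_H_has_derivative[OF assms]]
  by (simp add: normal_gauss_map_def half_space_H_def)

text \<open>Near \<open>F p\<close> the null coordinate keeps its sign \<open>?e\<close>, so there
  \<open>half_space_S\<close> is \<open>?e\<close> times \<open>half_space_H\<close>. The sign
  appears again in the third coordinate and cancels.\<close>

lemma normal_gauss_map_S:
  assumes "null_coord (F p) \<noteq> 0"
  shows "normal_gauss_map half_space_S F \<nu> p = gauss_vec (F p) (\<nu> p)"
proof -
  let ?e = "sgn (null_coord (F p))"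
  let ?O = "{V. ?e * null_coord V > 0}"
  have "(half_space_S has_derivative (\<lambda>h. ?e *\<^sub>R ((1 / null_coord (F p)) *\<^sub>R gauss_vec (F p) h))) (at (F p))"
  proof (rule has_derivative_transform_within_open)
    show "((\<lambda>V. ?e *\<^sub>R half_space_H V) has_derivative
        (\<lambda>h. ?e *\<^sub>R ((1 / null_coord (F p)) *\<^sub>R gauss_vec (F p) h))) (at (F p))"
      by (intro has_derivative_scaleR_right half_space_H_has_derivative assms)
    show "open ?O" by (intro open_Collect_less continuous_intros)
    show "F p \<in> ?O" using assms by (simp add: sgn_real_def)
    show "?e *\<^sub>R half_space_H V = half_space_S V" if "V \<in> ?O" for V
    proof -
      have "\<bar>null_coord V\<bar> = ?e * null_coord V" "?e \<noteq> 0" "?e = 1 \<or> ?e = -1"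
        using that assms by (auto simp: sgn_real_def abs_if split: if_splits)
      moreover have "- (a / null_coord V) = a / - null_coord V" for a by (simp only: divide_minus_right)
      ultimately show ?thesis
        unfolding half_space_S_def
        by (auto simp del: minus_diff_eq simp: half_space_H_def vec_eq_iff forall_3)
    qed
  qed
  then have "frechet_derivative half_space_S (at (F p)) =
      (\<lambda>h. ?e *\<^sub>R ((1 / null_coord (F p)) *\<^sub>R gauss_vec (F p) h))"
    by (rule frechet_derivative_eqI)
  moreover have "\<bar>null_coord (F p)\<bar> * (?e * (1 / null_coord (F p))) = 1"
    using assms by (auto simp: sgn_real_def abs_if)
  ultimately show ?thesis
    by (simp add: normal_gauss_map_def half_space_S_def mult.assoc)
qed

text \<open>\<open>e\<close> is the differential of \<open>g - u f\<close>, whose null coordinate is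
  identically zero, so the Minkowski product of its values involves components 1 and 2 only.
  Orthogonality to \<open>f\<close> isolates the term \<open>u' v * u' w * mink (f x) (f x)\<close>,
  which the third component of \<open>D\<close> accounts for. The square of \<open>f\<close> being
  -1 or 1 gives the Euclidean or the Lorentzian product.\<close>

lemma gauss_vec_derivative:
  assumes f: "(f has_derivative f') (at x)" and g: "(g has_derivative g') (at x)"
    and nz: "null_coord (f x) \<noteq> 0"
    and orth: "\<And>v. mink (f x) (f' v) = 0" "\<And>v. mink (f x) (g' v) = 0"
  defines "u \<equiv> null_coord (g x) / null_coord (f x)"
  obtains D where "((\<lambda>y. gauss_vec (f y) (g y)) has_derivative D) (at x)"
    and "\<And>v w. D v $ 1 * D w $ 1 + D v $ 2 * D w $ 2 - mink (f x) (f x) * (D v $ 3 * D w $ 3)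
      = mink (g' v - u *\<^sub>R f' v) (g' w - u *\<^sub>R f' w)"
proof -
  define u' where "u' h = (null_coord (g' h) - u * null_coord (f' h)) / null_coord (f x)" for h
  define e where "e h = g' h - u *\<^sub>R f' h - u' h *\<^sub>R f x" for h
  let ?D = "\<lambda>h. vector [e h $ 1, e h $ 2, - u' h] :: real^3"
  have du: "((\<lambda>y. null_coord (g y) / null_coord (f y)) has_derivative u') (at x)"
    unfolding u'_def u_def by (intro has_derivative_quotient has_derivative_null_coord f g nz)
  have de: "((\<lambda>y. g y $ i - null_coord (g y) / null_coord (f y) * f y $ i) has_derivative (\<lambda>h. e h $ i)) (at x)" for i
  proof -
    have "((\<lambda>y. g y $ i - null_coord (g y) / null_coord (f y) * f y $ i) has_derivative
      (\<lambda>h. g' h $ i - (u * f' h $ i + u' h * f x $ i))) (at x)"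
      unfolding u_def by (intro has_derivative_diff has_derivative_mult has_derivative_component f g
          du[unfolded u_def])
    then show ?thesis by (simp add: e_def algebra_simps)
  qed
  have D: "((\<lambda>y. gauss_vec (f y) (g y)) has_derivative ?D) (at x)"
    unfolding gauss_vec_def by (intro has_derivative_vector_3 de has_derivative_minus du)
  have e03: "e h $ 0 = e h $ 3" for h
    using nz by (simp add: e_def u'_def field_simps)
  have "mink (e v) (e w) = mink (g' v - u *\<^sub>R f' v) (g' w - u *\<^sub>R f' w) + u' v * u' w * mink (f x) (f x)" for v w
    using orth by (simp add: e_def mink_simps mink_commute[of "f' v" "f x"] mink_commute[of "g' v" "f x"])
  moreover have "mink (e v) (e w) = e v $ 1 * e w $ 1 + e v $ 2 * e w $ 2" for v w
    by (simp add: mink_def e03)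
  ultimately show thesis using that[OF D] by (simp add: algebra_simps)
qed

text \<open>The frame decomposition shows that a coefficient exists; pairing with the normal, which
  kills the tangent plane and the position vector, shows that it is unique.\<close>

lemma second_form_eq:
  assumes "linear (diff_map c F p)" "inj (diff_map c F p)"
    and "mink (F p) (F p) \<noteq> 0" "mink (\<nu> p) (\<nu> p) \<noteq> 0" "mink (\<nu> p) (F p) = 0"
    and "\<And>v. mink (F p) (diff_map c F p v) = 0" "\<And>v. mink (\<nu> p) (diff_map c F p v) = 0"
  shows "second_form c F \<nu> p v w = mink (diff2_map c F p v w) (\<nu> p) / mink (\<nu> p) (\<nu> p)"
proof -
  let ?W = "ambient_cov c F p v w"
  have F: "mink (F p) ?W = 0" using assms(3)
    by (simp add: ambient_cov_def mink_simps mink_commute[of "F p" "diff2_map c F p v w"])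
  have nu: "mink (\<nu> p) ?W = mink (diff2_map c F p v w) (\<nu> p)"
    using assms(5) by (simp add: ambient_cov_def mink_simps mink_commute[of "\<nu> p" "diff2_map c F p v w"])
  obtain a b z where W: "?W = a *\<^sub>R F p + b *\<^sub>R \<nu> p + diff_map c F p z"
    by (rule mink_frame_decomposition[of "diff_map c F p" "F p" "\<nu> p" ?W]) (use assms in auto)
  have a: "a = 0" using F assms unfolding W by (simp add: mink_simps mink_commute[of "F p" "\<nu> p"])
  have b: "b = mink (diff2_map c F p v w) (\<nu> p) / mink (\<nu> p) (\<nu> p)"
    using nu assms(4,5,7) unfolding W by (simp add: mink_simps eq_divide_eq)
  show ?thesis unfolding second_form_def
  proof (rule the_equality)
    show "?W - (mink (diff2_map c F p v w) (\<nu> p) / mink (\<nu> p) (\<nu> p)) *\<^sub>R \<nu> p \<in> range (diff_map c F p)"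
      unfolding b[symmetric] W a by simp
  next
    fix h assume "?W - h *\<^sub>R \<nu> p \<in> range (diff_map c F p)"
    then have "mink (\<nu> p) (?W - h *\<^sub>R \<nu> p) = 0" using assms(7) by auto
    then show "h = mink (diff2_map c F p v w) (\<nu> p) / mink (\<nu> p) (\<nu> p)"
      using nu assms(4) by (simp add: mink_simps field_simps)
  qed
qed

section \<open>Pairs of surfaces that are Gauss maps of each other\<close>

locale dual_surfaces =
  fixes M :: "'m topology" and A :: "'m chart set" and X N :: "'m \<Rightarrow> real^4"
  assumes surface: "smooth_surface M A"
    and immersed_X: "immersed_in M A H3 X"
    and immersed_N: "immersed_in M A S13 N" and spacelike_N: "spacelike A N"
    and gauss_map_X: "generalized_gauss_map M A S13 X N"
    and gauss_map_N: "generalized_gauss_map M A H3 N X"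
    and not_umbilic: "\<And>p. p \<in> topspace M \<Longrightarrow> \<not> umbilic A X N p"
begin

section \<open>Charts and the first derivatives of both maps\<close>

abbreviation region :: "'m chart \<Rightarrow> (real^2) set" where "region c \<equiv> snd c ` fst c"

lemma chart:
  assumes "c \<in> A"
  shows "open (region c)" "inj_on (snd c) (fst c)" "fst c \<subseteq> topspace M" "is_chart M c"
proof -
  show *: "is_chart M c" using surface assms by (auto simp: smooth_surface_def)
  then show "open (region c)" by (simp add: is_chart_def)
  show **: "fst c \<subseteq> topspace M" using * by (simp add: is_chart_def openin_subset)
  show "inj_on (snd c) (fst c)"
    using * ** homeomorphic_imp_injective_map by (fastforce simp: is_chart_def Int_absorb1)
qed

lemma in_chart_apply: "c \<in> A \<Longrightarrow> p \<in> fst c \<Longrightarrow> in_chart c f (snd c p) = f p"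
  using chart(2) by (simp add: in_chart_def)

lemma covered: "p \<in> topspace M \<Longrightarrow> \<exists>c\<in>A. p \<in> fst c"
  using surface by (auto simp: smooth_surface_def)

lemma chart_overlap_open:
  assumes "c \<in> A" "c' \<in> A"
  shows "open (snd c ` (fst c \<inter> fst c'))"
proof -
  have h: "homeomorphic_map (subtopology M (fst c)) (top_of_set (region c)) (snd c)"
    and o: "openin M (fst c')" "open (region c)"
    using chart(4)[OF assms(1)] chart(4)[OF assms(2)] by (auto simp: is_chart_def)
  have "openin (subtopology M (fst c)) (fst c \<inter> fst c')"
    using o(1) by (metis inf_commute openin_subtopology_Int)
  then have "openin (top_of_set (region c)) (snd c ` (fst c \<inter> fst c'))"
    using h by (meson homeomorphic_imp_open_map open_map_def)
  then show ?thesis using o(2) openin_open_trans by blast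
qed

lemma smooth_XN:
  assumes "c \<in> A"
  shows "smooth_on (in_chart c X) (region c)" "smooth_on (in_chart c N) (region c)"
  using immersed_X immersed_N assms chart(3)[OF assms]
  by (auto simp: immersed_in_def smooth_map_on_def Int_absorb2)

lemma has_derivative_XN:
  assumes "c \<in> A" "p \<in> fst c"
  shows "(in_chart c X has_derivative diff_map c X p) (at (snd c p))"
    "(in_chart c N has_derivative diff_map c N p) (at (snd c p))"
  unfolding diff_map_def[abs_def]
  using has_derivative_frechet_on_open[OF smooth_on_imp(1) chart(1)] smooth_XN assms by blast+

lemma mink_values:
  assumes "p \<in> topspace M"
  shows "mink (X p) (X p) = -1" "mink (N p) (N p) = 1" "mink (N p) (X p) = 0"
    "null_coord (X p) > 0"
proof -
  have "X p \<in> H3" "N p \<in> S13" using assms immersed_X immersed_N by (auto simp: immersed_in_def)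
  then show *: "mink (X p) (X p) = -1" "mink (N p) (N p) = 1" by (auto simp: H3_def S13_def)
  show "mink (N p) (X p) = 0" using gauss_map_X assms by (simp add: generalized_gauss_map_def)
  \<comment> \<open>On the upper sheet \<open>X0\<close> is positive and exceeds the absolute value
    of \<open>X3\<close>.\<close>
  have "(X p $ 0)\<^sup>2 = 1 + (X p $ 1)\<^sup>2 + (X p $ 2)\<^sup>2 + (X p $ 3)\<^sup>2" "X p $ 0 > 0"
    using * \<open>X p \<in> H3\<close> by (auto simp: H3_def mink_def power2_eq_square)
  then have "(X p $ 3)\<^sup>2 < (X p $ 0)\<^sup>2" by (smt (verit) zero_le_power2)
  then show "null_coord (X p) > 0" using \<open>X p $ 0 > 0\<close>
    by (smt (verit) power_mono)
qed

lemma mink_diff_map: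
  assumes c: "c \<in> A" and p: "p \<in> fst c"
  shows "mink (X p) (diff_map c X p v) = 0" "mink (N p) (diff_map c N p v) = 0"
    "mink (N p) (diff_map c X p v) = 0" "mink (X p) (diff_map c N p v) = 0"
proof -
  note d = has_derivative_XN[OF c p]
  have dom: "mink (in_chart c X y) (in_chart c X y) = -1" "mink (in_chart c N y) (in_chart c N y) = 1"
    if "y \<in> region c" for y
    using that mink_values chart(3)[OF c] by (auto simp: in_chart_apply c)
  show "mink (X p) (diff_map c X p v) = 0"
    using mink_constant_derivative[OF d(1) d(1) chart(1)[OF c] _ dom(1), of v] p
    by (simp add: in_chart_apply c mink_commute[of "diff_map c X p v" "X p"])
  show "mink (N p) (diff_map c N p v) = 0"
    using mink_constant_derivative[OF d(2) d(2) chart(1)[OF c] _ dom(2), of v] p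
    by (simp add: in_chart_apply c mink_commute[of "diff_map c N p v" "N p"])
  show "mink (N p) (diff_map c X p v) = 0" "mink (X p) (diff_map c N p v) = 0"
    using gauss_map_X gauss_map_N c p by (auto simp: generalized_gauss_map_def)
qed

lemma gauss_pair:
  assumes c: "c \<in> A" and p: "p \<in> fst c"
  shows "gauss_pair (X p) (N p) (diff_map c X p) (diff_map c N p)"
proof (rule gauss_pair.intro)
  have t: "p \<in> topspace M" using chart(3) assms by blast
  show "linear (diff_map c X p)" "linear (diff_map c N p)"
    using has_derivative_XN[OF c p] has_derivative_linear by blast+
  show "inj (diff_map c X p)" using immersed_X c p by (simp add: immersed_in_def)
  show "mink (X p) (X p) = -1" "mink (N p) (N p) = 1" "mink (N p) (X p) = 0"
    using mink_values t by auto
  show "mink (diff_map c N p v) (diff_map c N p v) > 0" if "v \<noteq> 0" for v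
    using spacelike_N that c p by (simp add: spacelike_def first_form_def)
qed (use mink_diff_map assms in auto)

text \<open>Weingarten's equation: differentiate the vanishing product of the normal with the field
  of constant coordinates \<open>w\<close>.\<close>

lemma mink_diff2_map:
  assumes c: "c \<in> A" and p: "p \<in> fst c"
  shows "mink (diff2_map c X p v w) (N p) = - mink (diff_map c X p w) (diff_map c N p v)"
    "mink (diff2_map c N p v w) (X p) = - mink (diff_map c N p w) (diff_map c X p v)"
proof -
  note d = has_derivative_XN[OF c p]
  have x: "snd c p \<in> region c" using p by simp
  have 1: "((\<lambda>y. frechet_derivative (in_chart c X) (at y) w) has_derivative (\<lambda>v. diff2_map c X p v w)) (at (snd c p))"
    "((\<lambda>y. frechet_derivative (in_chart c N) (at y) w) has_derivative (\<lambda>v. diff2_map c N p v w)) (at (snd c p))"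
    unfolding diff2_map_def
    using has_derivative_frechet_on_open[OF smooth_on_imp(2) chart(1)[OF c] x] smooth_XN[OF c] by auto
  have 2: "mink (frechet_derivative (in_chart c X) (at y) w) (in_chart c N y) = 0"
     "mink (frechet_derivative (in_chart c N) (at y) w) (in_chart c X y) = 0" if "y \<in> region c" for y
    using that mink_diff_map(3,4)[OF c]
    by (auto simp: in_chart_apply c diff_map_def mink_commute[of "frechet_derivative (in_chart c _) (at _) w"])
  show "mink (diff2_map c X p v w) (N p) = - mink (diff_map c X p w) (diff_map c N p v)"
    using mink_constant_derivative[OF 1(1) d(2) chart(1)[OF c] x 2(1), of v]
    by (simp add: in_chart_apply c p diff_map_def)
  show "mink (diff2_map c N p v w) (X p) = - mink (diff_map c N p w) (diff_map c X p v)"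
    using mink_constant_derivative[OF 1(2) d(1) chart(1)[OF c] x 2(2), of v]
    by (simp add: in_chart_apply c p diff_map_def)
qed

section \<open>Second fundamental forms and independence of the chart\<close>

lemma second_form_X:
  assumes c: "c \<in> A" and p: "p \<in> fst c"
  shows "second_form c X N p v w = - mink (diff_map c X p w) (diff_map c N p v)"
proof -
  interpret gauss_pair "X p" "N p" "diff_map c X p" "diff_map c N p" by (rule gauss_pair[OF c p])
  show ?thesis
    using second_form_eq[of c X p N v w] linear inj XX NN NX XP NP mink_diff2_map[OF c p] by simp
qed

text \<open>The normal \<open>X\<close> is time-like, so dividing by its square -1 flips the sign in
  comparison with \<open>second_form_X\<close>.\<close>

lemma second_form_N:
  assumes c: "c \<in> A" and p: "p \<in> fst c"
  shows "second_form c N X p v w = mink (diff_map c N p w) (diff_map c X p v)"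
proof -
  interpret gauss_pair "X p" "N p" "diff_map c X p" "diff_map c N p" by (rule gauss_pair[OF c p])
  have "inj (diff_map c N p)" using immersed_N c p by (simp add: immersed_in_def)
  then show ?thesis
    using second_form_eq[of c N p X v w] linear XX NN NX XQ NQ mink_diff2_map[OF c p]
    by (simp add: mink_commute[of "X p" "N p"])
qed

text \<open>Chain rule with the differential \<open>J\<close> of the transition map. The same
  \<open>J\<close> serves both surfaces, so relations between their differentials carry
  over.\<close>

lemma diff_map_transition:
  assumes c: "c \<in> A" "p \<in> fst c" and c': "c' \<in> A" "p \<in> fst c'"
  obtains J where "\<And>v. diff_map c' X p v = diff_map c X p (J v)"
    and "\<And>v. diff_map c' N p v = diff_map c N p (J v)"
proof -
  let ?O = "snd c' ` (fst c' \<inter> fst c)"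
  have o: "open ?O" by (rule chart_overlap_open[OF c'(1) c(1)])
  have x: "snd c' p \<in> ?O" using c c' by simp
  have "smooth_on (in_chart c' (snd c)) ?O"
    using surface c c' by (simp add: smooth_surface_def)
  then obtain J where J: "(in_chart c' (snd c) has_derivative J) (at (snd c' p))"
    using has_derivative_frechet_on_open[OF smooth_on_imp(1) o x] by blast
  have y: "in_chart c' (snd c) (snd c' p) = snd c p"
    using c' by (simp add: in_chart_apply)
  have "diff_map c' F p v = diff_map c F p (J v)"
    if F: "(in_chart c F has_derivative diff_map c F p) (at (snd c p))" for F :: "'m \<Rightarrow> real^4" and v
  proof -
    have "((in_chart c F \<circ> in_chart c' (snd c)) has_derivative (diff_map c F p \<circ> J)) (at (snd c' p))"
      using J F y by (intro diff_chain_at) simp_all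
    then have "(in_chart c' F has_derivative (diff_map c F p \<circ> J)) (at (snd c' p))"
      by (rule has_derivative_transform_within_open[OF _ o x])
        (use c c' in \<open>auto simp: in_chart_apply\<close>)
    then show ?thesis by (simp add: diff_map_def[of c'] frechet_derivative_eqI)
  qed
  then show thesis using that[of J] has_derivative_XN[OF c] by blast
qed

text \<open>\<open>umbilic\<close> asks for one \<open>r\<close> valid in all charts, so its
  negation speaks of some chart only; proportionality in one chart is carried to every other
  chart.\<close>

lemma not_umbilic_in_chart:
  assumes c: "c \<in> A" "p \<in> fst c"
  shows "\<exists>v w. - mink (diff_map c X p w) (diff_map c N p v) \<noteq> r * mink (diff_map c X p v) (diff_map c X p w)"
proof (rule ccontr)
  assume "\<not> ?thesis"
  then have *: "- mink (diff_map c X p w) (diff_map c N p v) = r * mink (diff_map c X p v) (diff_map c X p w)" for v w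
    by blast
  have "second_form c' X N p v w = r * first_form c' X p v w" if c': "c' \<in> A" "p \<in> fst c'" for c' v w
  proof -
    obtain J where J: "\<And>v. diff_map c' X p v = diff_map c X p (J v)"
      "\<And>v. diff_map c' N p v = diff_map c N p (J v)"
      by (rule diff_map_transition[OF c c']) blast
    show ?thesis using * unfolding second_form_X[OF c'] first_form_def J by blast
  qed
  then have "umbilic A X N p" unfolding umbilic_def by blast
  then show False using not_umbilic chart(3) c by blast
qed

section \<open>Fourth fundamental forms\<close>

abbreviation slope :: "'m \<Rightarrow> real" where
  "slope p \<equiv> null_coord (N p) / null_coord (X p)"

lemma null_coord_nonzero_open:
  assumes c: "c \<in> A"
  shows "open (region c \<inter> {y. null_coord (in_chart c N y) \<noteq> 0})" "open (region c \<inter> {y. null_coord (in_chart c X y) \<noteq> 0})"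
proof -
  have "continuous_on (region c) (in_chart c N)" "continuous_on (region c) (in_chart c X)"
    using smooth_XN[OF c] smooth_on_imp(1) differentiable_imp_continuous_on by blast+
  then have "continuous_on (region c) (\<lambda>y. null_coord (in_chart c N y))"
    "continuous_on (region c) (\<lambda>y. null_coord (in_chart c X y))"
    by (auto intro!: continuous_intros)
  then have "open (region c \<inter> (\<lambda>y. null_coord (in_chart c N y)) -` (- {0}))"
     "open (region c \<inter> (\<lambda>y. null_coord (in_chart c X y)) -` (- {0}))"
    using continuous_open_preimage[OF _ chart(1)[OF c] open_Compl[OF closed_singleton]] by blast+
  then show "open (region c \<inter> {y. null_coord (in_chart c N y) \<noteq> 0})"
    "open (region c \<inter> {y. null_coord (in_chart c X y) \<noteq> 0})"
    by (simp_all add: vimage_def)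
qed

lemma diff_map_gauss_vec:
  assumes c: "c \<in> A" "p \<in> fst c"
    and eq: "\<And>q. q \<in> fst c \<Longrightarrow> null_coord (F q) \<noteq> 0 \<Longrightarrow> \<eta> q = gauss_vec (F q) (G q)"
    and o: "open (region c \<inter> {y. null_coord (in_chart c F y) \<noteq> 0})"
    and nz: "null_coord (F p) \<noteq> 0"
    and d: "((\<lambda>y. gauss_vec (in_chart c F y) (in_chart c G y)) has_derivative D) (at (snd c p))"
  shows "diff_map c \<eta> p = D"
proof -
  have "(in_chart c \<eta> has_derivative D) (at (snd c p))"
    by (rule has_derivative_transform_within_open[OF d o])
      (use c nz eq in \<open>auto simp: in_chart_apply\<close>)
  then show ?thesis by (auto simp: diff_map_def fun_eq_iff frechet_derivative_eqI)
qed

lemma fourth_form_X: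
  assumes c: "c \<in> A" and p: "p \<in> fst c"
  defines "Y \<equiv> \<lambda>v. diff_map c N p v - slope p *\<^sub>R diff_map c X p v"
  shows "fourth_form (\<lambda>v w. v \<bullet> w) c (normal_gauss_map half_space_H X N) p v w = mink (Y v) (Y w)"
proof -
  have t: "p \<in> topspace M" using chart(3) assms by blast
  have nz: "null_coord (X p) \<noteq> 0" using mink_values(4)[OF t] by simp
  obtain D where D: "((\<lambda>y. gauss_vec (in_chart c X y) (in_chart c N y)) has_derivative D) (at (snd c p))"
    and e: "\<And>v w. D v $ 1 * D w $ 1 + D v $ 2 * D w $ 2 - mink (X p) (X p) * (D v $ 3 * D w $ 3)
      = mink (Y v) (Y w)"
    by (rule gauss_vec_derivative[OF has_derivative_XN[OF c p], unfolded in_chart_apply[OF c p]])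
      (use nz mink_diff_map[OF c p] in \<open>auto simp: Y_def\<close>)
  have "diff_map c (normal_gauss_map half_space_H X N) p = D"
    by (rule diff_map_gauss_vec[OF c p _ null_coord_nonzero_open(2)[OF c] nz D]) (rule normal_gauss_map_H)
  then show ?thesis using e[of v w] mink_values(1)[OF t]
    by (simp add: fourth_form_def inner_vec_def sum_3)
qed

lemma fourth_form_N:
  assumes c: "c \<in> A" and p: "p \<in> fst c" and nz: "null_coord (N p) \<noteq> 0"
  defines "Y \<equiv> \<lambda>v. diff_map c N p v - slope p *\<^sub>R diff_map c X p v"
  shows "fourth_form lor3 c (normal_gauss_map half_space_S N X) p v w = mink (Y v) (Y w) / (slope p)\<^sup>2"
proof -
  have t: "p \<in> topspace M" using chart(3) assms by blast
  let ?u = "null_coord (X p) / null_coord (N p)"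
  have nz': "null_coord (X p) \<noteq> 0" using mink_values(4)[OF t] by simp
  obtain D where D: "((\<lambda>y. gauss_vec (in_chart c N y) (in_chart c X y)) has_derivative D) (at (snd c p))"
    and e: "\<And>v w. D v $ 1 * D w $ 1 + D v $ 2 * D w $ 2 - mink (N p) (N p) * (D v $ 3 * D w $ 3)
      = mink (diff_map c X p v - ?u *\<^sub>R diff_map c N p v) (diff_map c X p w - ?u *\<^sub>R diff_map c N p w)"
    by (rule gauss_vec_derivative[OF has_derivative_XN(2)[OF c p] has_derivative_XN(1)[OF c p],
          unfolded in_chart_apply[OF c p]])
      (use nz mink_diff_map[OF c p] in auto)
  \<comment> \<open>Exchanging the surfaces inverts the slope and rescales \<open>Y\<close> by
    \<open>- ?u\<close>, which enters the form squared.\<close>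
  have "diff_map c X p v - ?u *\<^sub>R diff_map c N p v = (- ?u) *\<^sub>R Y v" for v
  proof -
    have u: "?u * slope p = 1" using nz nz' by simp
    show ?thesis
      by (simp only: Y_def scaleR_diff_right scaleR_scaleR mult_minus_left u) simp
  qed
  moreover have "?u = inverse (slope p)" by simp
  ultimately have "mink (diff_map c X p v - ?u *\<^sub>R diff_map c N p v) (diff_map c X p w - ?u *\<^sub>R diff_map c N p w)
     = mink (Y v) (Y w) / (slope p)\<^sup>2" for v w
    by (simp only: mink_simps) (simp add: power2_eq_square divide_inverse)
  moreover have "diff_map c (normal_gauss_map half_space_S N X) p = D"
    by (rule diff_map_gauss_vec[OF c p _ null_coord_nonzero_open(1)[OF c] nz D]) (rule normal_gauss_map_S)
  ultimately show ?thesis using e[of v w] mink_values(2)[OF t]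
    by (simp add: fourth_form_def lor3_def)
qed

text \<open>If the null coordinate of \<open>N\<close> vanished near \<open>p\<close>, so would its
  differential there, and the null vector \<open>(1,0,0,1)\<close> would be orthogonal to
  \<open>N\<close> and to its tangent plane.\<close>

lemma null_coord_nonzero_dense:
  assumes c: "c \<in> A" and p: "p \<in> fst c" and V: "open V" "snd c p \<in> V"
  shows "\<exists>q\<in>fst c. snd c q \<in> V \<and> null_coord (N q) \<noteq> 0"
proof (rule ccontr)
  assume *: "\<not> ?thesis"
  interpret gauss_pair "X p" "N p" "diff_map c X p" "diff_map c N p" by (rule gauss_pair[OF c p])
  have zero: "null_coord (in_chart c N y) = 0" if "y \<in> region c \<inter> V" for y
    using that * by (auto simp: in_chart_apply c)
  have "((\<lambda>y. null_coord (in_chart c N y)) has_derivative (\<lambda>v. 0)) (at (snd c p))"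
    by (rule has_derivative_transform_within_open[of "\<lambda>y. 0" _ _ _ "region c \<inter> V"])
      (use c p V chart(1) zero in auto)
  then have "(\<lambda>v. null_coord (diff_map c N p v)) = (\<lambda>v. 0)"
    by (rule has_derivative_unique[OF has_derivative_null_coord[OF has_derivative_XN(2)[OF c p]]])
  then have d: "null_coord (diff_map c N p v) = 0" for v
    by (rule fun_cong)
  \<comment> \<open>Pairing with this vector gives minus the null coordinate.\<close>
  define L :: "real^4" where "L = (\<chi> i. if i = 0 \<or> i = 3 then 1 else 0)"
  have L: "mink L W = - null_coord W" for W by (simp add: mink_def L_def)
  have "L = 0"
  proof (rule null_vector_not_orthogonal[of "diff_map c N p" "X p" "N p"])
    show "inj (diff_map c N p)" using immersed_N c p by (simp add: immersed_in_def)
    show "mink L L = 0" unfolding L by (simp add: L_def)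
    show "mink L (N p) = 0" unfolding L using zero[of "snd c p"] p V by (simp add: in_chart_apply c)
    show "mink L (diff_map c N p v) = 0" for v unfolding L d by simp
  qed (use linear XX NN NX XQ NQ pos in auto)
  moreover have "L $ 0 = 1" by (simp add: L_def)
  ultimately show False by simp
qed

lemma conformal_at:
  assumes c: "c \<in> A" and p: "p \<in> fst c"
    and conf: "\<And>v w. mink (diff_map c N p v - slope p *\<^sub>R diff_map c X p v)
      (diff_map c N p w - slope p *\<^sub>R diff_map c X p w) = \<rho> * - mink (diff_map c X p w) (diff_map c N p v)"
  shows "gauss_pair.det_II (diff_map c X p) (diff_map c N p) = (slope p)\<^sup>2 * gauss_pair.det_I (diff_map c X p)"
    "gauss_pair.det_III (diff_map c N p) = (slope p)^4 * gauss_pair.det_I (diff_map c X p)"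
    "null_coord (N p) \<noteq> 0"
proof -
  interpret gauss_pair "X p" "N p" "diff_map c X p" "diff_map c N p" by (rule gauss_pair[OF c p])
  note * = conformal_det[OF conf not_umbilic_in_chart[OF c p]]
  show "det_II = (slope p)\<^sup>2 * det_I" "det_III = (slope p)^4 * det_I" by (rule *)+
  show "null_coord (N p) \<noteq> 0" using *(3) by auto
qed

lemma continuous_on_mink:
  assumes "continuous_on S f" "continuous_on S g"
  shows "continuous_on S (\<lambda>y. mink (f y) (g y))"
  unfolding mink_def by (intro continuous_intros assms)

text \<open>At a zero of the null coordinate of \<open>N\<close>, continuity of the relation between
  \<open>det_II\<close> and \<open>det_I\<close> would force \<open>det_II = 0\<close>, contrary to
  \<open>det_relations\<close>.\<close>

lemma conformal_on_dense_imp_null_coord_nonzero: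
  assumes conf: "\<And>c p. c \<in> A \<Longrightarrow> p \<in> fst c \<Longrightarrow> null_coord (N p) \<noteq> 0 \<Longrightarrow>
    \<exists>\<rho>. \<forall>v w. mink (diff_map c N p v - slope p *\<^sub>R diff_map c X p v)
      (diff_map c N p w - slope p *\<^sub>R diff_map c X p w) = \<rho> * - mink (diff_map c X p w) (diff_map c N p v)"
    and p: "p \<in> topspace M"
  shows "null_coord (N p) \<noteq> 0"
proof
  assume z: "null_coord (N p) = 0"
  obtain c where c: "c \<in> A" and pc: "p \<in> fst c" using covered p by blast
  define a b where "a i y = frechet_derivative (in_chart c X) (at y) (axis i 1)"
    and "b i y = frechet_derivative (in_chart c N) (at y) (axis i 1)" for i :: 2 and y
  \<comment> \<open>The defect of \<open>det_II = slope^2 * det_I\<close> with the denominator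
    cleared. It is nonzero at \<open>p\<close>, hence at nearby points, some of which have nonzero
    null coordinate.\<close>
  define D where "D y = (mink (a 1 y) (b 1 y) * mink (a 2 y) (b 2 y) - mink (a 2 y) (b 1 y) * mink (a 1 y) (b 2 y))
      * (null_coord (in_chart c X y))\<^sup>2 - (null_coord (in_chart c N y))\<^sup>2 *
      (mink (a 1 y) (a 1 y) * mink (a 2 y) (a 2 y) - mink (a 1 y) (a 2 y) * mink (a 2 y) (a 1 y))" for y
  have Dq: "D (snd c q) = gauss_pair.det_II (diff_map c X q) (diff_map c N q) * (null_coord (X q))\<^sup>2
      - (null_coord (N q))\<^sup>2 * gauss_pair.det_I (diff_map c X q)" if "q \<in> fst c" for q
    using that c by (simp add: D_def a_def b_def diff_map_def in_chart_apply)
  have "continuous_on (region c) (a i)" "continuous_on (region c) (b i)" for i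
    unfolding a_def[abs_def] b_def[abs_def]
    using smooth_XN[OF c] smooth_on_imp(2) differentiable_imp_continuous_on by blast+
  moreover have "continuous_on (region c) (in_chart c X)" "continuous_on (region c) (in_chart c N)"
    using smooth_XN[OF c] smooth_on_imp(1) differentiable_imp_continuous_on by blast+
  ultimately have "continuous_on (region c) D"
    unfolding D_def[abs_def] by (intro continuous_intros continuous_on_mink)
  then have "open (region c \<inter> D -` (- {0}))"
    using continuous_open_preimage[OF _ chart(1)[OF c] open_Compl[OF closed_singleton]] by blast
  moreover have "snd c p \<in> region c \<inter> D -` (- {0})"
  proof -
    interpret gauss_pair "X p" "N p" "diff_map c X p" "diff_map c N p" by (rule gauss_pair[OF c pc])
    have "det_II \<noteq> 0" by (rule det_relations) auto
    moreover have "null_coord (X p) \<noteq> 0" using mink_values(4)[OF p] by simp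
    ultimately have "D (snd c p) \<noteq> 0" unfolding Dq[OF pc] z by simp
    then show ?thesis using pc by simp
  qed
  ultimately obtain q where q: "q \<in> fst c" "D (snd c q) \<noteq> 0" "null_coord (N q) \<noteq> 0"
    using null_coord_nonzero_dense[OF c pc] by fastforce
  have "null_coord (X q) \<noteq> 0" using mink_values(4)[of q] chart(3)[OF c] q(1) by auto
  moreover obtain \<rho> where "\<And>v w. mink (diff_map c N q v - slope q *\<^sub>R diff_map c X q v)
      (diff_map c N q w - slope q *\<^sub>R diff_map c X q w) = \<rho> * - mink (diff_map c X q w) (diff_map c N q v)"
    using conf[OF c q(1,3)] by blast
  then have "gauss_pair.det_II (diff_map c X q) (diff_map c N q)
      = (slope q)\<^sup>2 * gauss_pair.det_I (diff_map c X q)"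
    by (rule conformal_at(1)[OF c q(1)])
  ultimately have "D (snd c q) = 0" unfolding Dq[OF q(1)] by (simp add: power_divide)
  then show False using q(2) by contradiction
qed

section \<open>Transfer of conformality and the volume elements\<close>

lemma in_half_spaces_iff: "p \<in> topspace M \<Longrightarrow> N p \<in> S_minus \<union> S_plus \<longleftrightarrow> null_coord (N p) \<noteq> 0"
  using mink_values(2) by (auto simp: S_minus_def S_plus_def S13_def)

abbreviation domain_N :: "'m set" where
  "domain_N \<equiv> {p \<in> topspace M. N p \<in> S_minus \<union> S_plus}"

lemma open_domain_N:
  assumes "c \<in> A"
  shows "open (snd c ` (fst c \<inter> domain_N))"
proof -
  have "fst c \<inter> domain_N = {q \<in> fst c. null_coord (N q) \<noteq> 0}"
    using chart(3)[OF assms] in_half_spaces_iff by blast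
  moreover have "snd c ` {q \<in> fst c. null_coord (N q) \<noteq> 0} = region c \<inter> {y. null_coord (in_chart c N y) \<noteq> 0}"
    by (auto simp: in_chart_apply assms)
  ultimately show ?thesis using null_coord_nonzero_open(1)[OF assms] by simp
qed

lemma smooth_map_rescale:
  assumes r: "smooth_map_on A domain_N r"
  shows "smooth_map_on A domain_N (\<lambda>p. - (r p * (null_coord (X p) / null_coord (N p))\<^sup>2))"
    and "smooth_map_on A domain_N (\<lambda>p. - (r p * (slope p)\<^sup>2))"
proof -
  have XN: "smooth_map_on A (topspace M) X" "smooth_map_on A (topspace M) N"
    using immersed_X immersed_N by (simp_all add: immersed_in_def)
  note * = smooth_map_on_rescale[OF bounded_linear_null_coord open_domain_N chart(2) _ _ r, of "topspace M"]
  show "smooth_map_on A domain_N (\<lambda>p. - (r p * (null_coord (X p) / null_coord (N p))\<^sup>2))"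
    by (rule *) (use XN in_half_spaces_iff in blast)+
  show "smooth_map_on A domain_N (\<lambda>p. - (r p * (slope p)\<^sup>2))"
    by (rule *) (use XN mink_values(4) in \<open>fastforce+\<close>)
qed

text \<open>As long as the second fundamental forms are not known to be symmetric, those of \<open>X\<close> and
  \<open>N\<close> are opposite only up to exchanging the arguments; this is harmless since the fourth fundamental form is symmetric.\<close>

lemma conformal_S13_iff:
  assumes "c \<in> A" "p \<in> fst c" "null_coord (N p) \<noteq> 0"
  shows "(\<forall>v w. fourth_form lor3 c (normal_gauss_map half_space_S N X) p v w = r * second_form c N X p v w)
   \<longleftrightarrow> (\<forall>v w. fourth_form (\<lambda>v w. v \<bullet> w) c (normal_gauss_map half_space_H X N) p v w
        = - (r * (slope p)\<^sup>2) * second_form c X N p v w)"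
proof -
  have "slope p \<noteq> 0" using assms mink_values(4) chart(3) by fastforce
  then show ?thesis
    unfolding fourth_form_X[OF assms(1,2)] fourth_form_N[OF assms]
      second_form_X[OF assms(1,2)] second_form_N[OF assms(1,2)]
    by (subst (2) all_comm)
      (simp add: field_simps mink_commute[of "diff_map c N p _ - _" "diff_map c N p _ - _"] mink_commute[of "diff_map c N p _" "diff_map c X p _"])
qed

lemma conformal_H3_imp_S13:
  assumes "conformal_in_H3 M A X N"
  shows "conformal_in_S13 M A N X"
proof -
  obtain r where r: "smooth_map_on A (topspace M) r"
    and e: "\<And>c p v w. c \<in> A \<Longrightarrow> p \<in> fst c \<inter> topspace M \<Longrightarrow>
      fourth_form (\<lambda>v w. v \<bullet> w) c (normal_gauss_map half_space_H X N) p v w = r p * second_form c X N p v w"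
    using assms unfolding conformal_in_H3_def normal_gauss_conformal_def by blast
  have "smooth_map_on A domain_N r"
    using r Ck_on_subset[of _ _ "snd c ` (fst c \<inter> topspace M)" "snd c ` (fst c \<inter> domain_N)" for c]
    unfolding smooth_map_on_def smooth_on_def by blast
  then have "smooth_map_on A domain_N (\<lambda>p. - (r p * (null_coord (X p) / null_coord (N p))\<^sup>2))"
    by (rule smooth_map_rescale)
  moreover have "fourth_form lor3 c (normal_gauss_map half_space_S N X) p v w =
      - (r p * (null_coord (X p) / null_coord (N p))\<^sup>2) * second_form c N X p v w"
    if c: "c \<in> A" and p: "p \<in> fst c \<inter> domain_N" for c p v w
  proof -
    have nz: "null_coord (N p) \<noteq> 0" "null_coord (X p) \<noteq> 0"
      using p in_half_spaces_iff mink_values(4) by fastforce+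
    then have "- (- (r p * (null_coord (X p) / null_coord (N p))\<^sup>2) * (slope p)\<^sup>2) = r p"
      by (simp add: power_divide)
    then show ?thesis
      using conformal_S13_iff[OF c _ nz(1), of "- (r p * (null_coord (X p) / null_coord (N p))\<^sup>2)"] e[OF c] p
      by simp
  qed
  ultimately show ?thesis
    unfolding conformal_in_S13_def normal_gauss_conformal_def by blast
qed

text \<open>The hypothesis only concerns \<open>domain_N\<close>. Since the null coordinate of
  \<open>N\<close> turns out to vanish nowhere, that set is all of \<open>M\<close>, and the
  rescaled factor is smooth everywhere.\<close>

lemma conformal_S13_imp_H3:
  assumes "conformal_in_S13 M A N X"
  shows "conformal_in_H3 M A X N"
proof -
  obtain r where r: "smooth_map_on A domain_N r"
    and e: "\<And>c p v w. c \<in> A \<Longrightarrow> p \<in> fst c \<inter> domain_N \<Longrightarrow>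
      fourth_form lor3 c (normal_gauss_map half_space_S N X) p v w = r p * second_form c N X p v w"
    using assms unfolding conformal_in_S13_def normal_gauss_conformal_def by blast
  have *: "fourth_form (\<lambda>v w. v \<bullet> w) c (normal_gauss_map half_space_H X N) p v w
        = - (r p * (slope p)\<^sup>2) * second_form c X N p v w"
    if c: "c \<in> A" and p: "p \<in> fst c" and nz: "null_coord (N p) \<noteq> 0" for c p v w
    using conformal_S13_iff[OF c p nz, of "r p"] e[OF c, of p] in_half_spaces_iff[of p] chart(3)[OF c] p nz
    by blast
  have "null_coord (N p) \<noteq> 0" if "p \<in> topspace M" for p
    by (rule conformal_on_dense_imp_null_coord_nonzero[OF _ that])
      (use * in \<open>simp only: fourth_form_X second_form_X; blast\<close>)
  then have "domain_N = topspace M" using in_half_spaces_iff by blast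
  then have "smooth_map_on A (topspace M) (\<lambda>p. - (r p * (slope p)\<^sup>2))"
    using smooth_map_rescale(2)[OF r] by simp
  then show ?thesis
    unfolding conformal_in_H3_def normal_gauss_conformal_def
    using * \<open>\<And>p. p \<in> topspace M \<Longrightarrow> null_coord (N p) \<noteq> 0\<close> by blast
qed

text \<open>The metric of \<open>N\<close> is the third fundamental form of \<open>X\<close>, so its
  determinant is the fourth power of the slope times that of \<open>X\<close>; take square
  roots.\<close>

lemma volume_density_N:
  assumes "conformal_in_H3 M A X N" and c: "c \<in> A" and p: "p \<in> fst c"
  shows "volume_density c N p = (slope p)\<^sup>2 * volume_density c X p"
proof -
  obtain r where e: "\<And>c p v w. c \<in> A \<Longrightarrow> p \<in> fst c \<inter> topspace M \<Longrightarrow>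
      fourth_form (\<lambda>v w. v \<bullet> w) c (normal_gauss_map half_space_H X N) p v w = r p * second_form c X N p v w"
    using assms unfolding conformal_in_H3_def normal_gauss_conformal_def by blast
  have "gauss_pair.det_III (diff_map c N p) = (slope p)^4 * gauss_pair.det_I (diff_map c X p)"
    by (rule conformal_at(2)[OF c p, of "r p"])
      (use e[OF c] p chart(3)[OF c] in \<open>simp add: fourth_form_X[OF c p, symmetric] second_form_X[OF c p, symmetric] subset_iff\<close>)
  then have "det (metric_in_chart c N (snd c p)) = ((slope p)\<^sup>2)\<^sup>2 * det (metric_in_chart c X (snd c p))"
    by (simp add: det_2 metric_in_chart_def diff_map_def)
  then show ?thesis
    by (simp only: volume_density_def real_sqrt_mult real_sqrt_abs abs_power2)
qed

end

theorem theorem4p2: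
  fixes M :: "'m topology" and A :: "'m chart set"
    and X N :: "'m \<Rightarrow> real^4"
  assumes "smooth_surface M A" and "connected_space M"
    and "immersed_in M A H3 X"
    and "\<forall>p\<in>topspace M. \<not> umbilic A X N p"
    and "\<forall>c\<in>A. \<forall>p\<in>fst c. gauss_curvature c X p \<noteq> -1"
    and "immersed_in M A S13 N" and "spacelike A N"
    and "\<forall>p\<in>topspace M. \<not> umbilic A N X p"
    and "\<forall>c\<in>A. \<forall>p\<in>fst c. gauss_curvature c N p \<noteq> 1"
    and "generalized_gauss_map M A S13 X N"
    and "generalized_gauss_map M A H3 N X"
  shows "(conformal_in_H3 M A X N \<longleftrightarrow> conformal_in_S13 M A N X) \<and>
    (conformal_in_H3 M A X N \<longrightarrow>
      (\<forall>c\<in>A. \<forall>p\<in>fst c. volume_density c N p =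
         ((N p $ 0 - N p $ 3) / (X p $ 3 - X p $ 0))\<^sup>2 * volume_density c X p))"
proof -
  interpret dual_surfaces M A X N
    using assms by unfold_locales auto
  \<comment> \<open>The denominator has the opposite sign to that of \<open>slope\<close>; squaring
    removes the difference.\<close>
  have "((N p $ 0 - N p $ 3) / (X p $ 3 - X p $ 0))\<^sup>2 = (slope p)\<^sup>2" for p
    by (simp add: power_divide power2_commute[of "X p $ 3"])
  then show ?thesis
    using conformal_H3_imp_S13 conformal_S13_imp_H3 volume_density_N by metis
qed

end
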